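(* The space $\mathbf{F}_{a,b,c}$, as a representation of $\mathfrak{sl}_{h+1}$, is isomorphic to the irreducible fundamental highest weight representation $V(\Lambda_b)$.
   Context: Let $n\ge1$. Label the block $(i,j)\in\mathbb{N}\times\mathbb{N}$ ($i$ horizontal, $j$ vertical coordinate) by $(i-j)\bmod(n+1)\in\mathbb{Z}/(n+1)\mathbb{Z}$; the diagonals are the sets of blocks with constant $i-j\in\mathbb{Z}$, and all blocks on a diagonal have the same label. Let $R_{a,b,c}$ be a rectangle of blocks with sides parallel to the axes which intersects at most one diagonal of any given label, and whose top-left, bottom-left and bottom-right blocks are labelled $a$, $b$, $c$ respectively. (These conditions determine its width, height and labelling, and $b$ lies between $a$ and $c$ along the cyclic labelling.) $\mathcal{P}_{a,b,c}$ is the set of Young diagrams contained in $R_{a,b,c}$ (with corner at the bottom-left block of $R_{a,b,c}$, including the empty one), and $\mathbf{F}_{a,b,c}=\bigoplus_{Y\in\mathcal{P}_{a,b,c}}\mathbb{C}|Y\rangle$. Let $D^{a,c}$ be the finite type $A$ Dynkin diagram (a path) given by the part of the affine $A_n$ diagram going from vertex $a$ to vertex $c$ along the cyclic labelling, via $b$; $I^{a,c}$ is its vertex set and $h=|I^{a,c}|$ its cardinality. For $i\in I^{a,c}$ define operators on $\mathbf{F}_{a,b,c}$: $e_i|Y\rangle=\sum|Y'\rangle$ over $Y'=Y\setminus\{s\}\in\mathcal{P}_{a,b,c}$ with $s\in Y$ labelled $i$; $f_i|Y\rangle=\sum|Y'\rangle$ over $Y'=Y\cup\{s\}\in\mathcal{P}_{a,b,c}$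 with $s\notin Y$ labelled $i$; $h_i|Y\rangle=(\#\text{addable}-\#\text{removable blocks of label }i)\,|Y\rangle$, where $s$ is addable (removable) if $Y\cup\{s\}$ (resp. $Y\setminus\{s\}$) lies in $\mathcal{P}_{a,b,c}$. These satisfy the Serre relations of type $D^{a,c}$, so $\langle e_i,f_i,h_i: i\in I^{a,c}\rangle\simeq\mathfrak{sl}_{h+1}$ acts on $\mathbf{F}_{a,b,c}$ with the $e_i,f_i,h_i$ acting as Chevalley generators. $\Lambda_b$ is the fundamental weight of $\mathfrak{sl}_{h+1}$ at the vertex $b$ of $D^{a,c}$. *)

theory Defs
  imports Complex_Main "HOL-Library.Function_Algebras" "Jordan_Normal_Form.Matrix"
begin

definition sl :: "nat \<Rightarrow> complex mat set" where
  "sl N = {X \<in> carrier_mat N N. (\<Sum>i<N. X $$ (i, i)) = 0}"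

definition lie_bracket :: "complex mat \<Rightarrow> complex mat \<Rightarrow> complex mat" where
  "lie_bracket X Y = X * Y - Y * X"

definition elem_mat :: "nat \<Rightarrow> nat \<Rightarrow> nat \<Rightarrow> complex mat" where
  "elem_mat N p q = mat N N (\<lambda>(i, j). if i = p \<and> j = q then 1 else 0)"

text \<open>
  The Chevalley generators of \<open>sl N\<close>.  The vertices of the Dynkin diagram are numbered
  \<open>0, \<dots>, N - 2\<close> from one end of the path to the other, matching the numbering of matrix rows
  from \<open>0\<close>.
\<close>

definition chev_e :: "nat \<Rightarrow> nat \<Rightarrow> complex mat" where
  "chev_e N p = elem_mat N p (Suc p)"

definition chev_f :: "nat \<Rightarrow> nat \<Rightarrow> complex mat" where
  "chev_f N p = elem_mat N (Suc p) p"

definition chev_h :: "nat \<Rightarrow> nat \<Rightarrow> complex mat" where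
  "chev_h N p = elem_mat N p p - elem_mat N (Suc p) (Suc p)"

text \<open>
  The representation space is a subspace \<open>V\<close> of an ambient complex vector space; only the values
  of \<open>\<rho> X v\<close> for \<open>X \<in> sl N\<close> and \<open>v \<in> V\<close> matter.
\<close>

locale sl_representation = vector_space scale
  for scale :: "complex \<Rightarrow> 'v::ab_group_add \<Rightarrow> 'v" (infixr \<open>*s\<close> 75) +
  fixes N :: nat and V :: "'v set" and \<rho> :: "complex mat \<Rightarrow> 'v \<Rightarrow> 'v"
  assumes subspace_V: "subspace V"
    and act_closed: "\<lbrakk>X \<in> sl N; v \<in> V\<rbrakk> \<Longrightarrow> \<rho> X v \<in> V"
    and act_add: "\<lbrakk>X \<in> sl N; v \<in> V; w \<in> V\<rbrakk> \<Longrightarrow> \<rho> X (v + w) = \<rho> X v + \<rho> X w"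
    and act_scale: "\<lbrakk>X \<in> sl N; v \<in> V\<rbrakk> \<Longrightarrow> \<rho> X (z *s v) = z *s \<rho> X v"
    and add_act: "\<lbrakk>X \<in> sl N; Y \<in> sl N; v \<in> V\<rbrakk> \<Longrightarrow> \<rho> (X + Y) v = \<rho> X v + \<rho> Y v"
    and scale_act: "\<lbrakk>X \<in> sl N; v \<in> V\<rbrakk> \<Longrightarrow> \<rho> (z \<cdot>\<^sub>m X) v = z *s \<rho> X v"
    and bracket_act:
      "\<lbrakk>X \<in> sl N; Y \<in> sl N; v \<in> V\<rbrakk> \<Longrightarrow> \<rho> (lie_bracket X Y) v = \<rho> X (\<rho> Y v) - \<rho> Y (\<rho> X v)"
begin

definition subrep :: "'v set \<Rightarrow> bool" where
  "subrep U \<longleftrightarrow> subspace U \<and> U \<subseteq> V \<and> (\<forall>X\<in>sl N. \<forall>u\<in>U. \<rho> X u \<in> U)"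

definition irreducible_rep :: bool where
  "irreducible_rep \<longleftrightarrow> V \<noteq> {0} \<and> (\<forall>U. subrep U \<longrightarrow> U = {0} \<or> U = V)"

text \<open>
  A weight \<open>\<mu>\<close> is given by its values \<open>\<mu> p\<close> on the simple coroots \<open>chev_h N p\<close>, which form a
  basis of the Cartan subalgebra.
\<close>

definition highest_weight_vector :: "(nat \<Rightarrow> complex) \<Rightarrow> 'v \<Rightarrow> bool" where
  "highest_weight_vector \<mu> v \<longleftrightarrow> v \<in> V \<and> v \<noteq> 0 \<and>
     (\<forall>p. Suc p < N \<longrightarrow> \<rho> (chev_e N p) v = 0 \<and> \<rho> (chev_h N p) v = \<mu> p *s v)"

definition highest_weight_rep :: "(nat \<Rightarrow> complex) \<Rightarrow> bool" where
  "highest_weight_rep \<mu> \<longleftrightarrow>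
     (\<exists>v. highest_weight_vector \<mu> v \<and> (\<forall>U. subrep U \<and> v \<in> U \<longrightarrow> U = V))"

end

text \<open>
  The irreducible representation \<open>V(\<mu>)\<close> of highest weight \<open>\<mu>\<close> is only determined up to isomorphism;
  the predicate says that the given representation is a model of it.
\<close>

definition is_irreducible_hw_rep ::
  "(complex \<Rightarrow> 'v::ab_group_add \<Rightarrow> 'v) \<Rightarrow> nat \<Rightarrow> 'v set \<Rightarrow> (complex mat \<Rightarrow> 'v \<Rightarrow> 'v) \<Rightarrow>
    (nat \<Rightarrow> complex) \<Rightarrow> bool" where
  "is_irreducible_hw_rep scale N V \<rho> \<mu> \<longleftrightarrow>
     sl_representation scale N V \<rho> \<and>
     sl_representation.irreducible_rep scale N V \<rho> \<and>
     sl_representation.highest_weight_rep scale N V \<rho> \<mu>"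

definition fundamental_weight :: "nat \<Rightarrow> nat \<Rightarrow> complex" where
  "fundamental_weight p q = (if q = p then 1 else 0)"

definition isomorphic_reps ::
  "nat \<Rightarrow>
   (complex \<Rightarrow> 'v::ab_group_add \<Rightarrow> 'v) \<Rightarrow> 'v set \<Rightarrow> (complex mat \<Rightarrow> 'v \<Rightarrow> 'v) \<Rightarrow>
   (complex \<Rightarrow> 'w::ab_group_add \<Rightarrow> 'w) \<Rightarrow> 'w set \<Rightarrow> (complex mat \<Rightarrow> 'w \<Rightarrow> 'w) \<Rightarrow> bool" where
  "isomorphic_reps N scale1 V \<rho> scale2 W \<sigma> \<longleftrightarrow>
     (\<exists>\<phi>. bij_betw \<phi> V W \<and>
       (\<forall>v\<in>V. \<forall>w\<in>V. \<phi> (v + w) = \<phi> v + \<phi> w) \<and>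
       (\<forall>z. \<forall>v\<in>V. \<phi> (scale1 z v) = scale2 z (\<phi> v)) \<and>
       (\<forall>X\<in>sl N. \<forall>v\<in>V. \<phi> (\<rho> X v) = \<sigma> X (\<phi> v)))"

type_synonym block = "nat \<times> nat"

fun diagonal :: "block \<Rightarrow> int" where
  "diagonal (i, j) = int i - int j"

text \<open>Elements of \<open>\<int>/(n+1)\<int>\<close> are represented by the integers \<open>0, \<dots>, n\<close>.\<close>

definition label :: "nat \<Rightarrow> block \<Rightarrow> int" where
  "label n s = diagonal s mod (int n + 1)"

definition is_rectangle :: "nat \<Rightarrow> int \<Rightarrow> int \<Rightarrow> int \<Rightarrow> block set \<Rightarrow> bool" where
  "is_rectangle n a b c R \<longleftrightarrow>
     (\<exists>x0 x1 y0 y1. x0 \<le> x1 \<and> y0 \<le> y1 \<and> R = {x0..x1} \<times> {y0..y1} \<and>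
        label n (x0, y1) = a \<and> label n (x0, y0) = b \<and> label n (x1, y0) = c) \<and>
     (\<forall>s\<in>R. \<forall>t\<in>R. label n s = label n t \<longrightarrow> diagonal s = diagonal t)"

text \<open>
  Young diagrams in the rectangle \<open>R\<close>: the subsets closed under moving left and down inside \<open>R\<close>, so
  that a nonempty one has its corner at the bottom-left block of \<open>R\<close>.
\<close>

definition young_diagrams :: "block set \<Rightarrow> block set set" where
  "young_diagrams R =
     {Y. Y \<subseteq> R \<and> (\<forall>(i, j)\<in>Y. \<forall>(i', j')\<in>R. i' \<le> i \<and> j' \<le> j \<longrightarrow> (i', j') \<in> Y)}"

definition fscale :: "complex \<Rightarrow> (block set \<Rightarrow> complex) \<Rightarrow> (block set \<Rightarrow> complex)" where
  "fscale z x = (\<lambda>Y. z * x Y)"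

definition ket :: "block set \<Rightarrow> (block set \<Rightarrow> complex)" where
  "ket Y = (\<lambda>Y'. if Y' = Y then 1 else 0)"

text \<open>Since \<open>R\<close> is finite, this is the direct sum of the lines spanned by the \<open>ket Y\<close>.\<close>

definition fock_space :: "block set \<Rightarrow> (block set \<Rightarrow> complex) set" where
  "fock_space R = {x. \<forall>Y. Y \<notin> young_diagrams R \<longrightarrow> x Y = 0}"

definition removable :: "nat \<Rightarrow> block set \<Rightarrow> int \<Rightarrow> block set \<Rightarrow> block set" where
  "removable n R i Y = {s. s \<in> Y \<and> label n s = i \<and> Y - {s} \<in> young_diagrams R}"

definition addable :: "nat \<Rightarrow> block set \<Rightarrow> int \<Rightarrow> block set \<Rightarrow> block set" where
  "addable n R i Y = {s. s \<notin> Y \<and> label n s = i \<and> Y \<union> {s} \<in> young_diagrams R}"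

definition extend_linearly ::
  "block set \<Rightarrow> (block set \<Rightarrow> (block set \<Rightarrow> complex)) \<Rightarrow> (block set \<Rightarrow> complex) \<Rightarrow> (block set \<Rightarrow> complex)"
where
  "extend_linearly R g x = (\<Sum>Y\<in>young_diagrams R. fscale (x Y) (g Y))"

definition op_e :: "nat \<Rightarrow> block set \<Rightarrow> int \<Rightarrow> (block set \<Rightarrow> complex) \<Rightarrow> (block set \<Rightarrow> complex)" where
  "op_e n R i = extend_linearly R (\<lambda>Y. \<Sum>s\<in>removable n R i Y. ket (Y - {s}))"

definition op_f :: "nat \<Rightarrow> block set \<Rightarrow> int \<Rightarrow> (block set \<Rightarrow> complex) \<Rightarrow> (block set \<Rightarrow> complex)" where
  "op_f n R i = extend_linearly R (\<lambda>Y. \<Sum>s\<in>addable n R i Y. ket (Y \<union> {s}))"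

definition op_h :: "nat \<Rightarrow> block set \<Rightarrow> int \<Rightarrow> (block set \<Rightarrow> complex) \<Rightarrow> (block set \<Rightarrow> complex)" where
  "op_h n R i = extend_linearly R
     (\<lambda>Y. fscale (of_nat (card (addable n R i Y)) - of_nat (card (removable n R i Y))) (ket Y))"

text \<open>
  The path \<open>a, a + 1, \<dots>, c\<close> (modulo \<open>n + 1\<close>).  Labels increase when going down and when going
  right, so this is the direction that passes through \<open>b\<close>.
\<close>

definition dynkin_vertices :: "nat \<Rightarrow> int \<Rightarrow> int \<Rightarrow> int set" where
  "dynkin_vertices n a c = {(a + k) mod (int n + 1) | k. 0 \<le> k \<and> k \<le> (c - a) mod (int n + 1)}"

text \<open>The number of the vertex \<open>i\<close> on the path starting at \<open>a\<close>, counted from \<open>0\<close>.\<close>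

definition vertex_pos :: "nat \<Rightarrow> int \<Rightarrow> int \<Rightarrow> nat" where
  "vertex_pos n a i = nat ((i - a) mod (int n + 1))"

definition is_fock_action ::
  "nat \<Rightarrow> int \<Rightarrow> int \<Rightarrow> block set \<Rightarrow>
   (complex mat \<Rightarrow> (block set \<Rightarrow> complex) \<Rightarrow> (block set \<Rightarrow> complex)) \<Rightarrow> bool" where
  "is_fock_action n a c R \<rho> \<longleftrightarrow>
     (let N = card (dynkin_vertices n a c) + 1 in
       sl_representation fscale N (fock_space R) \<rho> \<and>
       (\<forall>i\<in>dynkin_vertices n a c. \<forall>x\<in>fock_space R.
          \<rho> (chev_e N (vertex_pos n a i)) x = op_e n R i x \<and>
          \<rho> (chev_f N (vertex_pos n a i)) x = op_f n R i x \<and>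
          \<rho> (chev_h N (vertex_pos n a i)) x = op_h n R i x))"

end

theory Submission
  imports Defs "HOL-Library.Product_Plus"
begin

text \<open>
  Read the boundary of a Young diagram in the rectangle as a path from the top left to the bottom
  right corner.  It has \<open>N = width + height = h + 1\<close> steps, \<open>height\<close> of them vertical, so recording
  the positions of the vertical steps identifies the Young diagrams with the \<open>height\<close>-element
  subsets of an \<open>N\<close>-element set, and the Fock space with the exterior power of \<open>\<complex>\<^sup>N\<close> of that degree.
  Adding a block of the \<open>p\<close>-th label moves a vertical step from position \<open>p\<close> to \<open>p + 1\<close>, which
  is what the Chevalley generator \<open>chev_f N p\<close> does on wedge products
  (\<open>maya_insert\<close>, \<open>block_for_hop\<close>).  Since no two diagonals share a label, at most one block is
  involved each time.

  The theorem has three parts.  \<^emph>\<open>Existence\<close> of the action: the exterior power carries a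
  representation of the Lie algebra of all \<open>N \<times> N\<close> matrices, built here from fermionic creation and annihilation
  operators, where the bracket relations follow from the anticommutation relations
  (\<open>hop_commutator\<close>, \<open>fermion_action_bracket\<close>).  It is transported to Young diagrams.

  \<^emph>\<open>Irreducibility\<close> of any action with the prescribed Chevalley generators: the kets have
  pairwise distinct weights, so a nonzero subrepresentation contains some ket
  (\<open>subrep_contains_ket\<close>).  Removing blocks leads to the empty diagram, and adding blocks leads from
  there to all others.  The empty diagram is a highest weight vector of weight \<open>\<Lambda>\<^sub>b\<close> because the
  only block that can be added to it is the bottom left one.

  \<^emph>\<open>Uniqueness\<close> of the irreducible representation with a given highest weight, on an arbitrary
  vector space (\<open>irreducible_hw_rep_unique\<close>): the pair of highest weight vectors generates the graph
  of an isomorphism in the product of the two representations.  The point to check is that the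
  highest weight space of this subrepresentation is a line (\<open>hw_line\<close>).
\<close>

section \<open>Traceless matrices\<close>

lemma lie_bracket_index:
  assumes "X \<in> carrier_mat N N" "Y \<in> carrier_mat N N" "i < N" "j < N"
  shows "lie_bracket X Y $$ (i, j) = (\<Sum>k<N. X $$ (i, k) * Y $$ (k, j)) - (\<Sum>k<N. Y $$ (i, k) * X $$ (k, j))"
  using assms by (simp add: lie_bracket_def scalar_prod_def atLeast0LessThan)

lemma lie_bracket_carrier:
  assumes "X \<in> carrier_mat N N" "Y \<in> carrier_mat N N"
  shows "lie_bracket X Y \<in> carrier_mat N N"
  unfolding lie_bracket_def using assms by (intro minus_carrier_mat mult_carrier_mat)

lemma lie_bracket_sl:
  assumes "X \<in> sl N" "Y \<in> sl N"
  shows "lie_bracket X Y \<in> sl N"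
proof -
  have c: "X \<in> carrier_mat N N" "Y \<in> carrier_mat N N"
    using assms by (auto simp: sl_def)
  have "(\<Sum>i<N. \<Sum>k<N. Y $$ (i, k) * X $$ (k, i)) = (\<Sum>i<N. \<Sum>k<N. X $$ (i, k) * Y $$ (k, i))"
    by (subst sum.swap) (simp add: mult.commute)
  then show ?thesis
    using c by (simp add: sl_def lie_bracket_carrier lie_bracket_index sum_subtractf)
qed

lemma add_sl: "X \<in> sl N \<Longrightarrow> Y \<in> sl N \<Longrightarrow> X + Y \<in> sl N"
  by (auto simp: sl_def sum.distrib)

lemma smult_sl: "X \<in> sl N \<Longrightarrow> z \<cdot>\<^sub>m X \<in> sl N"
  by (auto simp: sl_def simp flip: sum_distrib_left)

lemma elem_mat_index [simp]:
  "i < N \<Longrightarrow> j < N \<Longrightarrow> elem_mat N p q $$ (i, j) = (if i = p \<and> j = q then 1 else 0)"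
  by (simp add: elem_mat_def)

lemma elem_mat_carrier [simp]: "elem_mat N p q \<in> carrier_mat N N"
  by (simp add: elem_mat_def)

lemma elem_mat_sl: "p \<noteq> q \<Longrightarrow> elem_mat N p q \<in> sl N"
  by (auto simp: sl_def intro!: sum.neutral)

lemma chev_e_sl: "chev_e N p \<in> sl N" and chev_f_sl: "chev_f N p \<in> sl N"
  by (simp_all add: chev_e_def chev_f_def elem_mat_sl)

lemma chev_h_carrier [simp]: "chev_h N p \<in> carrier_mat N N"
  unfolding chev_h_def by (intro minus_carrier_mat elem_mat_carrier)

lemma chev_h_index [simp]:
  "i < N \<Longrightarrow> j < N \<Longrightarrow> chev_h N p $$ (i, j) = 
     (if i = p \<and> j = p then 1 else 0) - (if i = Suc p \<and> j = Suc p then 1 else 0)"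
  by (simp add: chev_h_def elem_mat_def)

lemma chev_h_sl: "Suc p < N \<Longrightarrow> chev_h N p \<in> sl N"
  by (simp add: sl_def sum_subtractf)

lemma lie_bracket_elem_mat:
  assumes "p < N" "q < N" "r < N" "p \<noteq> r"
  shows "lie_bracket (elem_mat N p q) (elem_mat N q r) = elem_mat N p r"
proof (rule eq_matI)
  fix i j assume "i < dim_row (elem_mat N p r)" "j < dim_col (elem_mat N p r)"
  then have ij: "i < N" "j < N" by (simp_all add: elem_mat_def)
  have "(\<Sum>k<N. (if i = p \<and> k = q then 1 else 0) * (if k = q \<and> j = r then 1 else 0)) =
      (\<Sum>k<N. if k = q then (if i = p \<and> j = r then 1 else 0) else (0::complex))"
    by (intro sum.cong) auto
  moreover have "(\<Sum>k<N. (if i = q \<and> k = r then 1 else 0) * (if k = p \<and> j = q then 1 else 0)) = (0::complex)"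
    using assms by (intro sum.neutral) auto
  ultimately show "lie_bracket (elem_mat N p q) (elem_mat N q r) $$ (i, j) = elem_mat N p r $$ (i, j)"
    using ij assms by (subst lie_bracket_index[of _ N]) auto
qed (simp_all add: lie_bracket_def elem_mat_def)

text \<open>
  The half sum of the positive coroots.  Its adjoint action gives a matrix unit below the diagonal
  a negative integral degree, so its eigenvalues on a highest weight representation measure the
  depth below the highest weight.
\<close>

definition grading_mat :: "nat \<Rightarrow> complex mat" where
  "grading_mat N = mat N N (\<lambda>(i, j). if i = j then (of_nat N - 1) / 2 - of_nat i else 0)"

lemma grading_mat_sl: "grading_mat N \<in> sl N"
proof -
  have "2 * (\<Sum>i<N. of_nat i) = of_nat N * (of_nat N - 1 :: complex)"
    by (induction N) (simp_all add: algebra_simps)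
  then have "(\<Sum>i<N. (of_nat N - 1) / 2 - of_nat i) = (0 :: complex)"
    by (simp add: sum_subtractf mult.commute flip: sum_divide_distrib)
  then show ?thesis
    by (simp add: sl_def grading_mat_def)
qed

lemma lie_bracket_grading:
  assumes "p < N" "q < N"
  shows "lie_bracket (grading_mat N) (elem_mat N p q) = (of_nat q - of_nat p) \<cdot>\<^sub>m elem_mat N p q"
proof (rule eq_matI)
  fix i j
  assume "i < dim_row ((of_nat q - of_nat p) \<cdot>\<^sub>m elem_mat N p q)"
    "j < dim_col ((of_nat q - of_nat p) \<cdot>\<^sub>m elem_mat N p q)"
  then have ij: "i < N" "j < N" by (simp_all add: elem_mat_def)
  let ?d = "\<lambda>i. (of_nat N - 1) / 2 - of_nat i :: complex"
  have "(\<Sum>k<N. (if i = k then ?d i else 0) * (if k = p \<and> j = q then 1 else 0)) =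
      (\<Sum>k<N. if i = k then (if i = p \<and> j = q then ?d p else 0) else 0)"
    by (intro sum.cong) auto
  moreover have "(\<Sum>k<N. (if i = p \<and> k = q then 1 else 0) * (if k = j then ?d k else 0)) =
      (\<Sum>k<N. if k = j then (if i = p \<and> j = q then ?d q else 0) else 0)"
    by (intro sum.cong) auto
  ultimately show "lie_bracket (grading_mat N) (elem_mat N p q) $$ (i, j) = ((of_nat q - of_nat p) \<cdot>\<^sub>m elem_mat N p q) $$ (i, j)"
    using ij assms
    by (subst lie_bracket_index[of _ N]) (auto simp: grading_mat_def elem_mat_def)
qed (simp_all add: lie_bracket_def elem_mat_def grading_mat_def)

text \<open>
  The zero matrix depends on the size, which is not part of the type, so a finite sum of matrices is
  formed entry by entry.
\<close>

definition lin_comb_mat :: "nat \<Rightarrow> ('k \<Rightarrow> complex) \<Rightarrow> ('k \<Rightarrow> complex mat) \<Rightarrow> 'k set \<Rightarrow> complex mat" where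
  "lin_comb_mat N c M K = mat N N (\<lambda>(i, j). \<Sum>k\<in>K. c k * M k $$ (i, j))"

lemma lin_comb_mat_closed:
  assumes "finite K" and "\<And>k. k \<in> K \<Longrightarrow> M k \<in> sl N \<and> P (M k)" and "P (0\<^sub>m N N)"
    and add: "\<And>A B. \<lbrakk>A \<in> sl N; B \<in> sl N; P A; P B\<rbrakk> \<Longrightarrow> P (A + B)"
    and scale: "\<And>A z. \<lbrakk>A \<in> sl N; P A\<rbrakk> \<Longrightarrow> P (z \<cdot>\<^sub>m A)"
  shows "lin_comb_mat N c M K \<in> sl N \<and> P (lin_comb_mat N c M K)"
  using assms(1,2)
proof (induction K rule: finite_induct)
  case empty
  have "lin_comb_mat N c M {} = 0\<^sub>m N N"
    by (auto simp: lin_comb_mat_def)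
  then show ?case
    using assms(3) by (simp add: sl_def)
next
  case (insert k K)
  have Mk: "M k \<in> sl N" "P (M k)" using insert.prems by auto
  have "lin_comb_mat N c M (insert k K) = c k \<cdot>\<^sub>m M k + lin_comb_mat N c M K"
    using insert.hyps Mk by (auto simp: lin_comb_mat_def sl_def)
  then show ?case
    using insert Mk add scale by (simp add: add_sl smult_sl)
qed

text \<open>
  The simple coroots span the traceless diagonal matrices.  Together with the matrix units off the
  diagonal they therefore span \<open>sl N\<close>, which is the content of the next two rules: a property closed
  under linear combinations need only be checked on these matrices.
\<close>

lemma diagonal_sl_induct [consumes 2, case_names zero add scale coroot]:
  assumes X: "X \<in> sl N" and diag: "\<forall>i<N. \<forall>j<N. i \<noteq> j \<longrightarrow> X $$ (i, j) = 0"
    and zero: "P (0\<^sub>m N N)"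
    and add: "\<And>A B. \<lbrakk>A \<in> sl N; B \<in> sl N; P A; P B\<rbrakk> \<Longrightarrow> P (A + B)"
    and scale: "\<And>A z. \<lbrakk>A \<in> sl N; P A\<rbrakk> \<Longrightarrow> P (z \<cdot>\<^sub>m A)"
    and chev_h: "\<And>p. Suc p < N \<Longrightarrow> P (chev_h N p)"
  shows "P X"
proof -
  \<comment> \<open>Abel summation: the coefficient of the coroot at \<open>p\<close> is the \<open>p\<close>-th partial trace.\<close>
  define c where "c p = (\<Sum>r\<le>p. X $$ (r, r))" for p
  let ?B = "lin_comb_mat N c (chev_h N) {..<N-1}"
  have "P ?B"
    using lin_comb_mat_closed[of "{..<N-1}" "chev_h N" N P c] assms by (auto simp: chev_h_sl)
  moreover have "X = ?B"
  proof (rule eq_matI)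
    fix i j assume "i < dim_row ?B" "j < dim_col ?B"
    then have ij: "i < N" "j < N" by (simp_all add: lin_comb_mat_def)
    show "X $$ (i, j) = ?B $$ (i, j)"
    proof (cases "i = j")
      case False
      then show ?thesis
        using ij diag by (auto simp: lin_comb_mat_def intro!: sum.neutral)
    next
      case True
      have eq: "?B $$ (i, i) = (\<Sum>p<N-1. c p * (if p = i then 1 else 0)) - (\<Sum>p<N-1. c p * (if Suc p = i then 1 else 0))"
        using ij True by (simp add: lin_comb_mat_def right_diff_distrib sum_subtractf eq_commute)
      have 1: "(\<Sum>p<N-1. c p * (if p = i then 1 else 0)) = c i"
      proof (cases "i < N - 1")
        case True
        then show ?thesis by (simp add: if_distrib cong: if_cong)
      next
        case False
        then have "{..i} = {..<N}" using ij by auto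
        then have "c i = 0" using X by (simp add: c_def sl_def)
        then show ?thesis using False by (simp add: if_distrib cong: if_cong)
      qed
      have 2: "(\<Sum>p<N-1. c p * (if Suc p = i then 1 else 0)) = c i - X $$ (i, i)"
      proof (cases i)
        case 0
        then show ?thesis by (simp add: c_def)
      next
        case (Suc k)
        then show ?thesis using ij by (simp add: c_def if_distrib cong: if_cong)
      qed
      show ?thesis using eq 1 2 True by simp
    qed
  qed (use X in \<open>auto simp: sl_def lin_comb_mat_def\<close>)
  ultimately show ?thesis by simp
qed

lemma sl_induct [consumes 1, case_names zero add scale root coroot]:
  assumes X: "X \<in> sl N"
    and zero: "P (0\<^sub>m N N)"
    and add: "\<And>A B. \<lbrakk>A \<in> sl N; B \<in> sl N; P A; P B\<rbrakk> \<Longrightarrow> P (A + B)"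
    and scale: "\<And>A z. \<lbrakk>A \<in> sl N; P A\<rbrakk> \<Longrightarrow> P (z \<cdot>\<^sub>m A)"
    and elem: "\<And>p q. \<lbrakk>p < N; q < N; p \<noteq> q\<rbrakk> \<Longrightarrow> P (elem_mat N p q)"
    and chev_h: "\<And>p. Suc p < N \<Longrightarrow> P (chev_h N p)"
  shows "P X"
proof -
  let ?K = "{(p, q). p < N \<and> q < N \<and> p \<noteq> q}"
  let ?A = "lin_comb_mat N (($$) X) (\<lambda>(p, q). elem_mat N p q) ?K"
  define D where "D = mat N N (\<lambda>(i, j). if i = j then X $$ (i, j) else 0)"
  have fin: "finite ?K"
    by (rule finite_subset[of _ "{..<N} \<times> {..<N}"]) auto
  have A: "?A \<in> sl N \<and> P ?A"
    using fin by (rule lin_comb_mat_closed) (use assms in \<open>auto simp: elem_mat_sl\<close>)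
  have D: "D \<in> sl N" using X by (simp add: sl_def D_def)
  have PD: "P D"
    by (rule diagonal_sl_induct[OF D]) (use assms in \<open>auto simp: D_def\<close>)
  have "X = ?A + D"
  proof (rule eq_matI)
    fix i j assume "i < dim_row (?A + D)" "j < dim_col (?A + D)"
    then have ij: "i < N" "j < N" by (simp_all add: D_def)
    have "?A $$ (i, j) = (\<Sum>k\<in>?K. if k = (i, j) then X $$ (i, j) else 0)"
      using ij by (auto simp: lin_comb_mat_def intro!: sum.cong)
    also have "\<dots> = (if i = j then 0 else X $$ (i, j))"
      using fin ij by (auto simp: sum.delta)
    finally show "X $$ (i, j) = (?A + D) $$ (i, j)"
      using ij by (auto simp: D_def)
  qed (use X in \<open>auto simp: sl_def D_def\<close>)
  moreover have "P (?A + D)"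
    using A D PD by (intro add) auto
  ultimately show ?thesis by simp
qed

section \<open>Highest weight vectors and the subrepresentations they generate\<close>

context sl_representation
begin

lemma zero_V: "0 \<in> V"
  and add_V: "v \<in> V \<Longrightarrow> w \<in> V \<Longrightarrow> v + w \<in> V"
  and scale_V: "v \<in> V \<Longrightarrow> z *s v \<in> V"
  using subspace_V by (auto intro: subspace_0 subspace_add subspace_scale)

lemma sum_V: "(\<And>k. k \<in> K \<Longrightarrow> f k \<in> V) \<Longrightarrow> sum f K \<in> V"
  using subspace_V by (rule subspace_sum)

lemma act_zero: "X \<in> sl N \<Longrightarrow> \<rho> X 0 = 0"
  using act_scale[of X 0 0] zero_V by simp

lemma act_sum:
  assumes "X \<in> sl N" "\<And>k. k \<in> K \<Longrightarrow> f k \<in> V"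
  shows "\<rho> X (sum f K) = (\<Sum>k\<in>K. \<rho> X (f k))"
  using assms(2)
proof (induction K rule: infinite_finite_induct)
  case (insert k K)
  then show ?case using assms(1) by (simp add: act_add sum_V)
qed (simp_all add: act_zero assms(1))

lemma zero_act: "v \<in> V \<Longrightarrow> \<rho> (0\<^sub>m N N) v = 0"
proof -
  assume v: "v \<in> V"
  have z: "0\<^sub>m N N \<in> sl N" by (simp add: sl_def)
  have "0 \<cdot>\<^sub>m 0\<^sub>m N N = (0\<^sub>m N N :: complex mat)" by auto
  then show ?thesis using scale_act[OF z v, of 0] by simp
qed

text \<open>
  The simple raising operators generate all matrix units above the diagonal by brackets, so a
  highest weight vector is killed by each of them.
\<close>

lemma hw_raising:
  assumes "highest_weight_vector \<mu> v" "p < q" "q < N"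
  shows "\<rho> (elem_mat N p q) v = 0"
proof -
  have v: "v \<in> V" and e: "\<And>p. Suc p < N \<Longrightarrow> \<rho> (elem_mat N p (Suc p)) v = 0"
    using assms(1) by (auto simp: highest_weight_vector_def chev_e_def)
  have "Suc (p + k) < N \<Longrightarrow> \<rho> (elem_mat N p (Suc (p + k))) v = 0" for k
  proof (induction k)
    case 0
    then show ?case using e by simp
  next
    case (Suc k)
    let ?X = "elem_mat N p (Suc (p + k))"
    let ?Y = "elem_mat N (Suc (p + k)) (Suc (Suc (p + k)))"
    have "\<rho> (lie_bracket ?X ?Y) v = 0"
      using Suc v e[of "Suc (p + k)"] by (simp add: bracket_act elem_mat_sl act_zero)
    then show ?case using Suc.prems by (simp add: lie_bracket_elem_mat)
  qed
  from this[of "q - Suc p"] show ?thesis using assms(2,3) by simp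
qed

lemma hw_cartan_scalar:
  assumes hw: "highest_weight_vector \<mu> v"
    and X: "X \<in> sl N" and diag: "\<forall>i<N. \<forall>j<N. i \<noteq> j \<longrightarrow> X $$ (i, j) = 0"
  shows "\<exists>d. \<rho> X v = d *s v"
  using X diag
proof (induction rule: diagonal_sl_induct)
  case zero
  show ?case using hw by (intro exI[of _ 0]) (simp add: zero_act highest_weight_vector_def)
next
  case (add A B)
  then show ?case using hw by (metis add_act highest_weight_vector_def scale_left_distrib)
next
  case (scale A z)
  then show ?case using hw by (metis scale_act highest_weight_vector_def scale_scale)
next
  case (coroot p)
  then show ?case using hw by (auto simp: highest_weight_vector_def)
qed

text \<open>
  Closing under the matrix units below the diagonal alone is what makes the grading visible: by
  construction all vectors are obtained by going down from \<open>v\<close>.  When \<open>v\<close> is a highest weight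
  vector, this is nevertheless the whole subrepresentation generated by it
  (\<open>subrep_lowering_span\<close>).
\<close>

inductive_set lowering_span :: "'v \<Rightarrow> 'v set" for v where
  gen: "v \<in> lowering_span v"
| add: "\<lbrakk>x \<in> lowering_span v; y \<in> lowering_span v\<rbrakk> \<Longrightarrow> x + y \<in> lowering_span v"
| scale: "x \<in> lowering_span v \<Longrightarrow> z *s x \<in> lowering_span v"
| lower: "\<lbrakk>x \<in> lowering_span v; q < p; p < N\<rbrakk> \<Longrightarrow> \<rho> (elem_mat N p q) x \<in> lowering_span v"

lemma subspace_lowering_span: "subspace (lowering_span v)"
  using lowering_span.scale[OF lowering_span.gen, of 0 v]
  by (intro subspaceI) (auto intro: lowering_span.intros)

lemma lowering_span_V:
  assumes "v \<in> V" "x \<in> lowering_span v"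
  shows "x \<in> V"
  using assms(2) by induction (auto simp: assms(1) add_V scale_V act_closed elem_mat_sl)

text \<open>
  A poor man's Poincare-Birkhoff-Witt argument.  If \<open>x\<close> is moved into the span by all of \<open>sl N\<close>
  and \<open>Y\<close> is a lowering operator, then so is \<open>Y x\<close>, because \<open>X Y x = Y (X x) + [X, Y] x\<close> and the
  bracket is again in \<open>sl N\<close>.  Only at \<open>v\<close> itself do the highest weight conditions enter.
\<close>

lemma subrep_lowering_span:
  assumes hw: "highest_weight_vector \<mu> v"
  shows "subrep (lowering_span v)"
proof -
  have v: "v \<in> V" using hw by (simp add: highest_weight_vector_def)
  let ?U = "lowering_span v"
  have UV: "x \<in> ?U \<Longrightarrow> x \<in> V" for x using lowering_span_V[OF v] .
  have "\<forall>X\<in>sl N. \<rho> X x \<in> ?U" if "x \<in> ?U" for x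
    using that
  proof induction
    case gen
    show ?case
    proof
      fix X assume "X \<in> sl N"
      then show "\<rho> X v \<in> ?U"
      proof (induction rule: sl_induct)
        case zero
        show ?case using v subspace_0[OF subspace_lowering_span] by (simp add: zero_act)
      next
        case (root p q)
        then show ?case
          using hw_raising[OF hw, of p q] subspace_0[OF subspace_lowering_span]
          by (cases "p < q") (auto intro: lowering_span.intros)
      next
        case (coroot p)
        then show ?case using hw by (auto simp: highest_weight_vector_def intro: lowering_span.intros)
      qed (auto simp: v add_act scale_act intro: lowering_span.intros)
    qed
  next
    case (add x y)
    then show ?case by (auto simp: UV act_add intro: lowering_span.intros)
  next
    case (scale x z)
    then show ?case by (auto simp: UV act_scale intro: lowering_span.intros)
  next
    case (lower x q p)
    show ?case
    proof
      fix X assume X: "X \<in> sl N"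
      let ?Y = "elem_mat N p q"
      have Y: "?Y \<in> sl N" using lower by (simp add: elem_mat_sl)
      have "\<rho> X (\<rho> ?Y x) = \<rho> ?Y (\<rho> X x) + \<rho> (lie_bracket X ?Y) x"
        using X Y lower UV by (simp add: bracket_act)
      moreover have "\<rho> ?Y (\<rho> X x) \<in> ?U"
        using lower X by (auto intro: lowering_span.intros)
      moreover have "\<rho> (lie_bracket X ?Y) x \<in> ?U"
        using lower lie_bracket_sl[OF X Y] by blast
      ultimately show "\<rho> X (\<rho> ?Y x) \<in> ?U"
        by (simp add: lowering_span.add)
    qed
  qed
  then show ?thesis
    using UV by (auto simp: subrep_def subspace_lowering_span)
qed

definition grade_space :: "complex \<Rightarrow> nat \<Rightarrow> 'v set" where
  "grade_space d k = {x \<in> V. \<rho> (grading_mat N) x = (d - of_nat k) *s x}"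

lemma grade_space_zero: "0 \<in> grade_space d k"
  by (simp add: grade_space_def zero_V act_zero grading_mat_sl)

lemma grade_space_add: "x \<in> grade_space d k \<Longrightarrow> y \<in> grade_space d k \<Longrightarrow> x + y \<in> grade_space d k"
  by (simp add: grade_space_def add_V act_add grading_mat_sl scale_right_distrib)

lemma grade_space_scale: "x \<in> grade_space d k \<Longrightarrow> z *s x \<in> grade_space d k"
  by (simp add: grade_space_def scale_V act_scale grading_mat_sl mult.commute)

lemma grade_space_lower:
  assumes x: "x \<in> grade_space d k" and "q < p" "p < N"
  shows "\<rho> (elem_mat N p q) x \<in> grade_space d (k + (p - q))"
proof -
  let ?D = "grading_mat N" and ?Y = "elem_mat N p q"
  have Y: "?Y \<in> sl N" using assms by (simp add: elem_mat_sl)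
  have xV: "x \<in> V" and Dx: "\<rho> ?D x = (d - of_nat k) *s x"
    using x by (auto simp: grade_space_def)
  have "\<rho> ?D (\<rho> ?Y x) = \<rho> ?Y (\<rho> ?D x) + \<rho> (lie_bracket ?D ?Y) x"
    using Y xV by (simp add: bracket_act grading_mat_sl)
  also have "\<dots> = (d - of_nat k) *s \<rho> ?Y x + (of_nat q - of_nat p) *s \<rho> ?Y x"
    using assms Y xV by (simp add: Dx act_scale lie_bracket_grading scale_act)
  also have "\<dots> = (d - of_nat (k + (p - q))) *s \<rho> ?Y x"
    using assms by (simp add: of_nat_diff algebra_simps flip: scale_left_distrib)
  finally show ?thesis
    using Y xV by (simp add: grade_space_def act_closed)
qed

lemma grade_spaces_independent:
  assumes "\<And>k. k \<le> K \<Longrightarrow> f k \<in> grade_space d k" and "(\<Sum>k\<le>K. f k) = 0" and "k \<le> K"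
  shows "f k = 0"
  using assms
proof (induction K arbitrary: f k)
  case 0
  then show ?case by simp
next
  case (Suc K)
  let ?D = "grading_mat N"
  have V: "f k \<in> V" and D: "\<rho> ?D (f k) = (d - of_nat k) *s f k" if "k \<le> Suc K" for k
    using Suc.prems(1)[OF that] by (auto simp: grade_space_def)
  \<comment> \<open>Applying \<open>D - (d - K - 1)\<close> kills the top component and rescales the others.\<close>
  have "(\<Sum>k\<le>Suc K. (d - of_nat k) *s f k) = \<rho> ?D (\<Sum>k\<le>Suc K. f k)"
    by (subst act_sum) (auto simp: V D grading_mat_sl)
  then have "(\<Sum>k\<le>Suc K. (d - of_nat k) *s f k) = 0"
    unfolding Suc.prems(2) by (simp add: act_zero grading_mat_sl)
  then have "0 = (\<Sum>k\<le>Suc K. (d - of_nat k) *s f k) - (d - of_nat (Suc K)) *s (\<Sum>k\<le>Suc K. f k)"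
    unfolding Suc.prems(2) by simp
  also have "\<dots> = (\<Sum>k\<le>Suc K. of_nat (Suc K - k) *s f k)"
    unfolding scale_sum_right sum_subtractf[symmetric] scale_left_diff_distrib[symmetric]
    by (intro sum.cong) (auto simp: of_nat_diff)
  also have "\<dots> = (\<Sum>k\<le>K. of_nat (Suc K - k) *s f k)"
    by simp
  finally have "(\<Sum>k\<le>K. of_nat (Suc K - k) *s f k) = 0" by simp
  then have "of_nat (Suc K - k) *s f k = 0" if "k \<le> K" for k
    using Suc.IH[of "\<lambda>k. of_nat (Suc K - k) *s f k" k] Suc.prems(1) that
    by (simp add: grade_space_scale)
  then have low: "f k = 0" if "k \<le> K" for k
    using that by (metis diff_is_0_eq not_less_eq_eq of_nat_eq_0_iff scale_eq_0_iff)
  moreover have "f (Suc K) = 0"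
    using Suc.prems(2) low by simp
  ultimately show ?case using Suc.prems(3) by (metis le_Suc_eq)
qed

text \<open>
  Every lowering operator strictly increases the degree, so the component of degree \<open>0\<close> never
  leaves the line through \<open>v\<close>.
\<close>

lemma lowering_span_graded:
  assumes v: "v \<in> grade_space d 0" and x: "x \<in> lowering_span v"
  shows "\<exists>f K. x = (\<Sum>k\<le>K. f k) \<and> (\<forall>k. f k \<in> grade_space d k) \<and> (\<forall>k>K. f k = 0) \<and> (\<exists>c. f 0 = c *s v)"
  using x
proof induction
  case gen
  show ?case
    using v by (intro exI[of _ "\<lambda>k. if k = 0 then v else 0"] exI[of _ 0] conjI exI[of _ 1])
      (auto simp: grade_space_zero)
next
  case (add x y)
  then obtain f K c g L c' where
    f: "x = (\<Sum>k\<le>K. f k)" "\<And>k. f k \<in> grade_space d k" "\<And>k. k > K \<Longrightarrow> f k = 0" "f 0 = c *s v" and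
    g: "y = (\<Sum>k\<le>L. g k)" "\<And>k. g k \<in> grade_space d k" "\<And>k. k > L \<Longrightarrow> g k = 0" "g 0 = c' *s v"
    by metis
  let ?M = "max K L"
  have "x = (\<Sum>k\<le>?M. f k)" "y = (\<Sum>k\<le>?M. g k)"
    unfolding f(1) g(1) by (auto intro!: sum.mono_neutral_left f(3) g(3))
  then show ?case
    using f g by (intro exI[of _ "\<lambda>k. f k + g k"] exI[of _ ?M] conjI exI[of _ "c + c'"])
      (auto simp: sum.distrib grade_space_add scale_left_distrib)
next
  case (scale x z)
  then obtain f K c where
    f: "x = (\<Sum>k\<le>K. f k)" "\<And>k. f k \<in> grade_space d k" "\<And>k. k > K \<Longrightarrow> f k = 0" "f 0 = c *s v"
    by metis
  show ?case
    using f by (intro exI[of _ "\<lambda>k. z *s f k"] exI[of _ K] conjI exI[of _ "z * c"])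
      (auto simp: scale_sum_right grade_space_scale)
next
  case (lower x q p)
  then obtain f K c where
    f: "x = (\<Sum>k\<le>K. f k)" "\<And>k. f k \<in> grade_space d k" "\<And>k. k > K \<Longrightarrow> f k = 0" "f 0 = c *s v"
    by metis
  let ?Y = "elem_mat N p q" and ?s = "p - q"
  have Y: "?Y \<in> sl N" using lower by (simp add: elem_mat_sl)
  have fV: "f k \<in> V" for k using f(2)[of k] by (simp add: grade_space_def)
  define g where "g k = (if k < ?s then 0 else \<rho> ?Y (f (k - ?s)))" for k
  have "\<rho> ?Y x = (\<Sum>k\<le>K. \<rho> ?Y (f k))"
    unfolding f(1) by (rule act_sum) (auto simp: Y fV)
  also have "\<dots> = (\<Sum>k\<in>{?s..K + ?s}. g k)"
    by (rule sum.reindex_bij_witness[of _ "\<lambda>k. k - ?s" "\<lambda>k. k + ?s"]) (auto simp: g_def)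
  also have "\<dots> = (\<Sum>k\<le>K + ?s. g k)"
    by (rule sum.mono_neutral_left) (auto simp: g_def)
  finally have "\<rho> ?Y x = (\<Sum>k\<le>K + ?s. g k)" .
  moreover have "g k \<in> grade_space d k" for k
    using grade_space_lower[OF f(2)[of "k - ?s"], of q p] lower.hyps
    by (auto simp: g_def grade_space_zero)
  moreover have "g k = 0" if "k > K + ?s" for k
    using that f(3) by (simp add: g_def act_zero Y)
  moreover have "g 0 = 0 *s v" using lower.hyps by (simp add: g_def)
  ultimately show ?case by blast
qed

text \<open>
  The highest weight space of the subrepresentation generated by \<open>v\<close> is one-dimensional, even
  when that of the ambient representation is not.  This is the crux of the uniqueness theorem.
\<close>

lemma hw_line:
  assumes hw: "highest_weight_vector \<mu> v" and x: "x \<in> lowering_span v"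
    and v: "\<rho> (grading_mat N) v = d *s v" and Dx: "\<rho> (grading_mat N) x = d *s x"
  shows "\<exists>c. x = c *s v"
proof -
  have V: "v \<in> V" "x \<in> V"
    using hw lowering_span_V x by (auto simp: highest_weight_vector_def)
  then have gr: "v \<in> grade_space d 0" "x \<in> grade_space d 0"
    using v Dx by (auto simp: grade_space_def)
  obtain f K c where
    f: "x = (\<Sum>k\<le>K. f k)" "\<And>k. f k \<in> grade_space d k" "f 0 = c *s v"
    using lowering_span_graded[OF gr(1) x] by metis
  \<comment> \<open>\<open>x\<close> has degree \<open>0\<close>, so moving it to the other side turns the decomposition into a vanishing
    sum of eigenvectors.\<close>
  define g where "g k = (if k = 0 then f 0 + (- 1) *s x else f k)" for k
  have "(\<Sum>k\<le>K. g k) = 0"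
    unfolding g_def atMost_Suc_eq_insert_0
    using f(1) by (cases K) (auto simp: sum.atMost_Suc_shift simp del: sum.atMost_Suc)
  moreover have "g k \<in> grade_space d k" for k
    using f(2) gr(2) by (auto simp: g_def intro: grade_space_add grade_space_scale simp del: scale_minus_left)
  ultimately have "g 0 = 0"
    using grade_spaces_independent[of K g d 0] by simp
  then show ?thesis using f(3) by (auto simp: g_def)
qed

end

section \<open>Uniqueness of irreducible highest weight representations\<close>

lemma product_representation:
  assumes "sl_representation s1 N V \<rho>" "sl_representation s2 N W \<sigma>"
  shows "sl_representation (\<lambda>z. map_prod (s1 z) (s2 z)) N (V \<times> W) (\<lambda>X. map_prod (\<rho> X) (\<sigma> X))"
proof -
  interpret A: sl_representation s1 N V \<rho> by fact
  interpret B: sl_representation s2 N W \<sigma> by fact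
  interpret vector_space "\<lambda>z. map_prod (s1 z) (s2 z)"
    by unfold_locales
      (auto simp: A.scale_right_distrib B.scale_right_distrib A.scale_left_distrib B.scale_left_distrib)
  show ?thesis
  proof
    show "subspace (V \<times> W)"
      by (intro subspaceI) (auto simp: zero_prod_def A.zero_V B.zero_V A.add_V B.add_V A.scale_V B.scale_V)
  qed (auto simp: A.act_closed B.act_closed A.act_add B.act_add A.act_scale B.act_scale A.add_act B.add_act
      A.scale_act B.scale_act A.bracket_act B.bracket_act)
qed

text \<open>
  Inside \<open>V \<times> W\<close> let \<open>U\<close> be generated by the pair \<open>(v, w)\<close> of highest weight vectors, which is
  itself one.  Both projections of \<open>U\<close> are nonzero subrepresentations, hence everything.
  The kernels of the projections are subrepresentations of \<open>W\<close> and \<open>V\<close>; were one of them everything,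
  \<open>U\<close> would contain \<open>(0, w)\<close> or \<open>(v, 0)\<close>, which has the same degree as \<open>(v, w)\<close> but is not
  proportional to it.  So \<open>U\<close> is the graph of an isomorphism.
\<close>

theorem irreducible_hw_rep_unique:
  assumes irr1: "is_irreducible_hw_rep s1 N V \<rho> \<mu>" and irr2: "is_irreducible_hw_rep s2 N W \<sigma> \<mu>"
  shows "isomorphic_reps N s1 V \<rho> s2 W \<sigma>"
proof -
  interpret A: sl_representation s1 N V \<rho> using irr1 by (simp add: is_irreducible_hw_rep_def)
  interpret B: sl_representation s2 N W \<sigma> using irr2 by (simp add: is_irreducible_hw_rep_def)
  interpret P: sl_representation "\<lambda>z. map_prod (s1 z) (s2 z)" N "V \<times> W" "\<lambda>X. map_prod (\<rho> X) (\<sigma> X)"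
    by (rule product_representation) unfold_locales
  have irrA: "A.subrep U \<Longrightarrow> U = {0} \<or> U = V" for U
    using irr1 by (simp add: is_irreducible_hw_rep_def A.irreducible_rep_def)
  have irrB: "B.subrep U \<Longrightarrow> U = {0} \<or> U = W" for U
    using irr2 by (simp add: is_irreducible_hw_rep_def B.irreducible_rep_def)
  obtain v where v: "A.highest_weight_vector \<mu> v"
    using irr1 by (auto simp: is_irreducible_hw_rep_def A.highest_weight_rep_def)
  obtain w where w: "B.highest_weight_vector \<mu> w"
    using irr2 by (auto simp: is_irreducible_hw_rep_def B.highest_weight_rep_def)
  have v0: "v \<in> V" "v \<noteq> 0" and w0: "w \<in> W" "w \<noteq> 0"
    using v w by (auto simp: A.highest_weight_vector_def B.highest_weight_vector_def)
  have vw: "P.highest_weight_vector \<mu> (v, w)"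
    using v w by (auto simp: P.highest_weight_vector_def A.highest_weight_vector_def
        B.highest_weight_vector_def zero_prod_def)
  define U where "U = P.lowering_span (v, w)"
  have U: "P.subrep U" unfolding U_def by (rule P.subrep_lowering_span[OF vw])
  then have sub: "U \<subseteq> V \<times> W" and U_0: "(0, 0) \<in> U"
    and U_add: "(x, y) \<in> U \<Longrightarrow> (x', y') \<in> U \<Longrightarrow> (x + x', y + y') \<in> U"
    and U_scale: "(x, y) \<in> U \<Longrightarrow> (s1 z x, s2 z y) \<in> U"
    and U_act: "X \<in> sl N \<Longrightarrow> (x, y) \<in> U \<Longrightarrow> (\<rho> X x, \<sigma> X y) \<in> U" for x y x' y' z X
    using P.subspace_0[of U] P.subspace_add[of U "(x, y)" "(x', y')"] P.subspace_scale[of U "(x, y)" z]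
    by (auto simp: P.subrep_def zero_prod_def dest!: bspec[where x = X] bspec[where x = "(x, y)"])
  have vwU: "(v, w) \<in> U" unfolding U_def by (rule P.lowering_span.gen)

  have "\<exists>d. map_prod (\<rho> (grading_mat N)) (\<sigma> (grading_mat N)) (v, w) = map_prod (s1 d) (s2 d) (v, w)"
    by (rule P.hw_cartan_scalar[OF vw grading_mat_sl]) (simp add: grading_mat_def)
  then obtain d where d: "\<rho> (grading_mat N) v = s1 d v" "\<sigma> (grading_mat N) w = s2 d w"
    by auto
  have notin: "(0, w) \<notin> U" "(v, 0) \<notin> U"
  proof -
    have "\<exists>c. (x, y) = map_prod (s1 c) (s2 c) (v, w)"
      if "(x, y) \<in> U" "\<rho> (grading_mat N) x = s1 d x" "\<sigma> (grading_mat N) y = s2 d y" for x y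
      using P.hw_line[OF vw, of "(x, y)" d] d that by (simp add: U_def)
    from this[of 0 w] this[of v 0] show "(0, w) \<notin> U" "(v, 0) \<notin> U"
      using d v0 w0 by (auto simp: A.act_zero B.act_zero grading_mat_sl)
  qed

  have U_snd: "(0, y) \<in> U \<Longrightarrow> (0, y') \<in> U \<Longrightarrow> (0, y + y') \<in> U" "(0, y) \<in> U \<Longrightarrow> (0, s2 z y) \<in> U"
    "X \<in> sl N \<Longrightarrow> (0, y) \<in> U \<Longrightarrow> (0, \<sigma> X y) \<in> U" for y y' z X
    using U_add[of 0 y 0 y'] U_scale[of 0 y z] U_act[of X 0 y] by (simp_all add: A.act_zero)
  have "B.subrep {y. (0, y) \<in> U}"
    unfolding B.subrep_def
  proof (intro conjI ballI B.subspaceI)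
    show "{y. (0, y) \<in> U} \<subseteq> W" using sub by auto
  qed (use U_0 U_snd in blast)+
  then have ker2: "(0, y) \<in> U \<longleftrightarrow> y = 0" for y
    using irrB notin(1) w0(1) U_0 by blast
  have U_fst: "(x, 0) \<in> U \<Longrightarrow> (x', 0) \<in> U \<Longrightarrow> (x + x', 0) \<in> U" "(x, 0) \<in> U \<Longrightarrow> (s1 z x, 0) \<in> U"
    "X \<in> sl N \<Longrightarrow> (x, 0) \<in> U \<Longrightarrow> (\<rho> X x, 0) \<in> U" for x x' z X
    using U_add[of x 0 x' 0] U_scale[of x 0 z] U_act[of X x 0] by (simp_all add: B.act_zero)
  have "A.subrep {x. (x, 0) \<in> U}"
    unfolding A.subrep_def
  proof (intro conjI ballI A.subspaceI)
    show "{x. (x, 0) \<in> U} \<subseteq> V" using sub by auto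
  qed (use U_0 U_fst in blast)+
  then have ker1: "(x, 0) \<in> U \<longleftrightarrow> x = 0" for x
    using irrA notin(2) v0(1) U_0 by blast

  have "A.subrep {x. \<exists>y. (x, y) \<in> U}"
    unfolding A.subrep_def
  proof (intro conjI ballI A.subspaceI)
    show "{x. \<exists>y. (x, y) \<in> U} \<subseteq> V" using sub by auto
  qed (use U_0 U_add U_scale U_act in blast)+
  then have dom: "\<exists>y. (x, y) \<in> U" if "x \<in> V" for x
    using irrA vwU v0 that by blast
  have "B.subrep {y. \<exists>x. (x, y) \<in> U}"
    unfolding B.subrep_def
  proof (intro conjI ballI B.subspaceI)
    show "{y. \<exists>x. (x, y) \<in> U} \<subseteq> W" using sub by auto
  qed (use U_0 U_add U_scale U_act in blast)+
  then have ran: "\<exists>x. (x, y) \<in> U" if "y \<in> W" for y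
    using irrB vwU w0 that by blast

  have U_diff: "(x - x', y - y') \<in> U" if "(x, y) \<in> U" "(x', y') \<in> U" for x y x' y'
    using U_add[OF that(1) U_scale[OF that(2), of "-1"]] by simp
  have fun1: "y = y'" if "(x, y) \<in> U" "(x, y') \<in> U" for x y y'
    using U_diff[OF that] ker2 by simp
  have fun2: "x = x'" if "(x, y) \<in> U" "(x', y) \<in> U" for x x' y
    using U_diff[OF that] ker1 by simp
  define \<phi> where "\<phi> x = (THE y. (x, y) \<in> U)" for x
  have \<phi>: "\<phi> x = y" if "(x, y) \<in> U" for x y
    unfolding \<phi>_def using that fun1 by blast
  have \<phi>U: "(x, \<phi> x) \<in> U" if "x \<in> V" for x
    using dom[OF that] \<phi> by auto
  show ?thesis
    unfolding isomorphic_reps_def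
  proof (intro exI[of _ \<phi>] conjI ballI allI)
    show "bij_betw \<phi> V W"
    proof (rule bij_betw_imageI)
      show "inj_on \<phi> V" by (intro inj_onI) (metis \<phi>U fun2)
      show "\<phi> ` V = W"
      proof
        show "\<phi> ` V \<subseteq> W" using \<phi>U sub by auto
        show "W \<subseteq> \<phi> ` V" using \<phi> sub ran by blast
      qed
    qed
  qed (simp_all add: \<phi>[OF U_add[OF \<phi>U \<phi>U]] \<phi>[OF U_scale[OF \<phi>U]] \<phi>[OF U_act[OF _ \<phi>U]])
qed

section \<open>Fermions and the exterior power representation\<close>

definition particle_sets :: "nat \<Rightarrow> nat \<Rightarrow> nat set set" where
  "particle_sets H N = {S. S \<subseteq> {..<N} \<and> card S = H}"

text \<open>
  A state \<open>g\<close> is given by its coefficients \<open>g S\<close>, where \<open>S\<close> is a set of occupied sites, so creating a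
  particle at \<open>p\<close> takes the coefficient at \<open>S\<close> from the one at \<open>S - {p}\<close>.  The sign counts the particles that the operator
  has to pass to reach site \<open>p\<close>.  It depends only on a finite part of the set, so the
  anticommutation relations below hold on all functions.
\<close>

definition fermion_sign :: "nat \<Rightarrow> nat set \<Rightarrow> complex" where
  "fermion_sign p S = (- 1) ^ card {k \<in> S. k < p}"

definition create :: "nat \<Rightarrow> (nat set \<Rightarrow> complex) \<Rightarrow> nat set \<Rightarrow> complex" where
  "create p g = (\<lambda>S. if p \<in> S then fermion_sign p S * g (S - {p}) else 0)"

definition annihilate :: "nat \<Rightarrow> (nat set \<Rightarrow> complex) \<Rightarrow> nat set \<Rightarrow> complex" where
  "annihilate p g = (\<lambda>S. if p \<in> S then 0 else fermion_sign p S * g (insert p S))"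

definition can_hop_right :: "nat \<Rightarrow> nat set \<Rightarrow> bool" where
  "can_hop_right p S \<longleftrightarrow> p \<in> S \<and> Suc p \<notin> S"

definition can_hop_left :: "nat \<Rightarrow> nat set \<Rightarrow> bool" where
  "can_hop_left p S \<longleftrightarrow> p \<notin> S \<and> Suc p \<in> S"

definition hop_right :: "nat \<Rightarrow> nat set \<Rightarrow> nat set" where
  "hop_right p S = insert (Suc p) (S - {p})"

definition hop_left :: "nat \<Rightarrow> nat set \<Rightarrow> nat set" where
  "hop_left p S = insert p (S - {Suc p})"

lemma hop_right_left: "can_hop_left p S \<Longrightarrow> hop_right p (hop_left p S) = S"
  and hop_left_right: "can_hop_right p S \<Longrightarrow> hop_left p (hop_right p S) = S"
  by (auto simp: can_hop_left_def can_hop_right_def hop_left_def hop_right_def)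

lemma can_hop_left_hop_right: "can_hop_right p S \<Longrightarrow> can_hop_left p (hop_right p S)"
  and can_hop_right_hop_left: "can_hop_left p S \<Longrightarrow> can_hop_right p (hop_left p S)"
  by (auto simp: can_hop_left_def can_hop_right_def hop_left_def hop_right_def)

lemma particle_sets_exchange:
  assumes "p \<in> S" "q \<notin> S - {p}" "p < N" "q < N"
  shows "insert q (S - {p}) \<in> particle_sets H N \<longleftrightarrow> S \<in> particle_sets H N"
proof (cases "S \<subseteq> {..<N}")
  case True
  then have "finite S" by (rule finite_subset) simp
  then have "card (insert q (S - {p})) = card S"
    using assms(1,2) by (subst card_insert_disjoint) (simp_all only: finite_Diff card_Suc_Diff1 not_False_eq_True)
  then show ?thesis using True assms by (auto simp: particle_sets_def)
next
  case False
  then show ?thesis using assms by (auto simp: particle_sets_def)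
qed

lemma hop_right_particle_sets:
  "S \<in> particle_sets H N \<Longrightarrow> can_hop_right p S \<Longrightarrow> Suc p < N \<Longrightarrow> hop_right p S \<in> particle_sets H N"
  unfolding hop_right_def can_hop_right_def by (subst particle_sets_exchange) auto

lemma hop_left_particle_sets:
  "S \<in> particle_sets H N \<Longrightarrow> can_hop_left p S \<Longrightarrow> hop_left p S \<in> particle_sets H N"
  unfolding hop_left_def can_hop_left_def
  by (subst particle_sets_exchange) (auto simp: particle_sets_def)

text \<open>
  Unless the particles occupy the first sites, some particle has a free site on its left.  Moving
  it there decreases the sum of the positions, so every configuration is reached from the packed one
  by hops to the right.
\<close>

lemma particle_sets_induct [consumes 1, case_names packed hop]:
  assumes S: "S \<in> particle_sets H N"
    and packed: "P {..<H}"
    and hop: "\<And>S p. \<lbrakk>S \<in> particle_sets H N; can_hop_right p S; Suc p < N; P S\<rbrakk> \<Longrightarrow> P (hop_right p S)"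
  shows "P S"
  using S
proof (induction "\<Sum>S" arbitrary: S rule: less_induct)
  case less
  have SN: "S \<subseteq> {..<N}" and card: "card S = H" using less.prems by (auto simp: particle_sets_def)
  have fin: "finite S" using SN by (rule finite_subset) simp
  show ?case
  proof (cases "\<exists>p. can_hop_left p S")
    case True
    then obtain p where p: "can_hop_left p S" by blast
    have pS: "p \<notin> S" "Suc p \<in> S" using p by (auto simp: can_hop_left_def)
    have "\<Sum>(hop_left p S) < \<Sum>S"
      using fin pS sum.remove[OF fin pS(2), of "\<lambda>x. x"] by (simp add: hop_left_def)
    then have "P (hop_left p S)"
      using less.hyps hop_left_particle_sets[OF less.prems p] by blast
    then have "P (hop_right p (hop_left p S))"
      using hop hop_left_particle_sets[OF less.prems p] can_hop_right_hop_left[OF p] pS SN by blast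
    then show ?thesis by (simp add: hop_right_left[OF p])
  next
    case False
    then have down: "Suc p \<in> S \<Longrightarrow> p \<in> S" for p by (auto simp: can_hop_left_def)
    have closed: "q \<le> p \<Longrightarrow> p \<in> S \<Longrightarrow> q \<in> S" for p q
      by (induction rule: inc_induct) (auto intro: down)
    have "S = {..<card S}"
    proof (cases "S = {}")
      case False
      have "S = {..Max S}"
        using Max_ge[OF fin] closed[OF _ Max_in[OF fin False]] by blast
      then have "card S = Suc (Max S)" by (metis card_atMost)
      then show ?thesis using \<open>S = {..Max S}\<close> by (simp add: lessThan_Suc_atMost)
    qed simp
    then show ?thesis using packed card by simp
  qed
qed

lemma fermion_sign_insert:
  "q \<notin> S \<Longrightarrow> fermion_sign p (insert q S) = (if q < p then - fermion_sign p S else fermion_sign p S)"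
proof -
  assume q: "q \<notin> S"
  have "{k \<in> insert q S. k < p} = (if q < p then insert q {k \<in> S. k < p} else {k \<in> S. k < p})"
    by auto
  then show ?thesis using q by (simp add: fermion_sign_def)
qed

lemma fermion_sign_remove:
  "q \<in> S \<Longrightarrow> fermion_sign p (S - {q}) = (if q < p then - fermion_sign p S else fermion_sign p S)"
  using fermion_sign_insert[of q "S - {q}" p] by (simp add: insert_absorb)

lemma fermion_sign_square: "fermion_sign p S * (fermion_sign p S * z) = z"
  by (simp add: fermion_sign_def flip: mult.assoc power_add)

lemma create_anticommute: "create p (create q g) = - create q (create p g)"
proof
  fix S
  have "S - {p} - {q} = S - {q} - {p}" by auto
  then show "create p (create q g) S = (- create q (create p g)) S"
    by (auto simp: create_def fermion_sign_remove)
qed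

lemma annihilate_anticommute: "annihilate p (annihilate q g) = - annihilate q (annihilate p g)"
  by (rule ext) (auto simp: annihilate_def fermion_sign_insert insert_commute)

lemma annihilate_create:
  "annihilate p (create q g) = (if p = q then g else 0) - create q (annihilate p g)"
proof
  fix S
  have "insert p (S - {q}) = insert p S - {q}" if "p \<noteq> q" using that by auto
  then show "annihilate p (create q g) S = ((if p = q then g else 0) - create q (annihilate p g)) S"
    by (auto simp: annihilate_def create_def fermion_sign_insert fermion_sign_remove
        fermion_sign_square insert_absorb)
qed

lemma create_diff: "create p (g - h) = create p g - create p h"
  and create_uminus: "create p (- g) = - create p g"
  and create_zero: "create p 0 = 0"
  by (auto simp: create_def algebra_simps)

definition hop :: "nat \<Rightarrow> nat \<Rightarrow> (nat set \<Rightarrow> complex) \<Rightarrow> nat set \<Rightarrow> complex" where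
  "hop p q g = create p (annihilate q g)"

text \<open>
  These are the commutation relations of the matrix units, so that
  \<open>X \<mapsto> \<Sum> X\<^sub>p\<^sub>q hop p q\<close> is a Lie algebra representation.
\<close>

lemma hop_commutator:
  "hop p q (hop r s g) - hop r s (hop p q g) =
     (if q = r then hop p s g else 0) - (if p = s then hop r q g else 0)"
proof -
  have 1: "hop p q (hop r s g) = (if q = r then hop p s g else 0) - create p (create r (annihilate q (annihilate s g)))"
    for p q r s
    by (simp add: hop_def annihilate_create create_diff create_zero)
  have 2: "create p (create r (annihilate q (annihilate s g))) = create r (create p (annihilate s (annihilate q g)))"
    by (subst create_anticommute, subst annihilate_anticommute) (simp add: create_uminus)
  show ?thesis
    unfolding 1[of p q r s] 1[of r s p q] 2 by auto
qed

text \<open>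
  For fixed sites and a fixed configuration the value depends on the state through a single
  coefficient, which makes linearity in every form immediate.
\<close>

lemma hop_monomial: "\<exists>c T. \<forall>g. hop p q g S = c * g T"
proof (cases "p \<in> S \<and> q \<notin> S - {p}")
  case True
  then show ?thesis
    by (intro exI[of _ "fermion_sign p S * fermion_sign q (S - {p})"] exI[of _ "insert q (S - {p})"])
      (auto simp: hop_def create_def annihilate_def)
next
  case False
  then show ?thesis
    by (intro exI[of _ 0]) (auto simp: hop_def create_def annihilate_def)
qed

lemma hop_linear:
  "hop p q (\<lambda>S. g S + h S) S = hop p q g S + hop p q h S"
  "hop p q (\<lambda>S. z * g S) S = z * hop p q g S"
  "hop p q (\<lambda>S. \<Sum>k\<in>K. f k S) S = (\<Sum>k\<in>K. hop p q (f k) S)"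
proof -
  obtain c T where "\<And>g. hop p q g S = c * g T"
    using hop_monomial by blast
  then show "hop p q (\<lambda>S. g S + h S) S = hop p q g S + hop p q h S"
    "hop p q (\<lambda>S. z * g S) S = z * hop p q g S"
    "hop p q (\<lambda>S. \<Sum>k\<in>K. f k S) S = (\<Sum>k\<in>K. hop p q (f k) S)"
    by (simp_all add: distrib_left sum_distrib_left)
qed

lemma hop_particle_sets:
  assumes "\<And>S. S \<notin> particle_sets H N \<Longrightarrow> g S = 0" and "p < N" "q < N" "S \<notin> particle_sets H N"
  shows "hop p q g S = 0"
  using assms particle_sets_exchange[of p S q N H] by (auto simp: hop_def create_def annihilate_def)

lemma hop_diag: "hop p p g S = (if p \<in> S then g S else 0)"
  by (auto simp: hop_def create_def annihilate_def fermion_sign_remove fermion_sign_square insert_absorb)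

text \<open>
  Between neighbouring sites the two signs cancel, so that the Chevalley generators act without
  signs, just as blocks are added to and removed from Young diagrams.
\<close>

lemma hop_from_right: "hop p (Suc p) g S = (if can_hop_right p S then g (hop_right p S) else 0)"
proof -
  have "{k \<in> S - {p}. k < Suc p} = {k \<in> S. k < p}" by auto
  then have "fermion_sign (Suc p) (S - {p}) = fermion_sign p S" by (simp add: fermion_sign_def)
  then show ?thesis
    by (auto simp: hop_def create_def annihilate_def can_hop_right_def hop_right_def fermion_sign_square)
qed

lemma hop_from_left: "hop (Suc p) p g S = (if can_hop_left p S then g (hop_left p S) else 0)"
proof -
  have "p \<notin> S \<Longrightarrow> {k \<in> S. k < Suc p} = {k \<in> S - {Suc p}. k < p}"
    by (auto simp: less_Suc_eq)
  then have "p \<notin> S \<Longrightarrow> fermion_sign (Suc p) S = fermion_sign p (S - {Suc p})"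
    by (simp add: fermion_sign_def)
  then show ?thesis
    by (auto simp: hop_def create_def annihilate_def can_hop_left_def hop_left_def fermion_sign_square)
qed

definition fermion_action :: "nat \<Rightarrow> complex mat \<Rightarrow> (nat set \<Rightarrow> complex) \<Rightarrow> nat set \<Rightarrow> complex" where
  "fermion_action N X g = (\<lambda>S. \<Sum>p<N. \<Sum>q<N. X $$ (p, q) * hop p q g S)"

lemma sum_swap_pairs:
  "(\<Sum>r\<in>A. \<Sum>s\<in>A. \<Sum>p\<in>A. \<Sum>q\<in>A. f p q r s) = (\<Sum>p\<in>A. \<Sum>q\<in>A. \<Sum>r\<in>A. \<Sum>s\<in>A. f p q r s)"
proof -
  have "(\<Sum>r\<in>A. \<Sum>s\<in>A. \<Sum>p\<in>A. \<Sum>q\<in>A. f p q r s) = (\<Sum>r\<in>A. \<Sum>p\<in>A. \<Sum>q\<in>A. \<Sum>s\<in>A. f p q r s)"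
    by (rule sum.cong[OF refl], subst sum.swap, rule sum.cong[OF refl], rule sum.swap)
  also have "\<dots> = (\<Sum>p\<in>A. \<Sum>q\<in>A. \<Sum>r\<in>A. \<Sum>s\<in>A. f p q r s)"
    by (subst sum.swap, rule sum.cong[OF refl], rule sum.swap)
  finally show ?thesis .
qed

lemma fermion_action_bracket:
  assumes X: "X \<in> carrier_mat N N" and Y: "Y \<in> carrier_mat N N"
  shows "fermion_action N (lie_bracket X Y) g S =
    fermion_action N X (fermion_action N Y g) S - fermion_action N Y (fermion_action N X g) S"
proof -
  have comp: "fermion_action N X (fermion_action N Y g) S =
    (\<Sum>p<N. \<Sum>q<N. \<Sum>r<N. \<Sum>s<N. X $$ (p, q) * Y $$ (r, s) * hop p q (hop r s g) S)" for X Y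
    by (simp add: fermion_action_def hop_linear sum_distrib_left mult.assoc)
  have comp': "fermion_action N Y (fermion_action N X g) S =
    (\<Sum>p<N. \<Sum>q<N. \<Sum>r<N. \<Sum>s<N. X $$ (p, q) * Y $$ (r, s) * hop r s (hop p q g) S)"
  proof -
    have "fermion_action N Y (fermion_action N X g) S =
      (\<Sum>r<N. \<Sum>s<N. \<Sum>p<N. \<Sum>q<N. X $$ (p, q) * Y $$ (r, s) * hop r s (hop p q g) S)"
      unfolding comp by (simp add: mult.commute)
    then show ?thesis by (rule trans) (rule sum_swap_pairs)
  qed
  have comm: "hop p q (hop r s g) S - hop r s (hop p q g) S =
     (if q = r then hop p s g S else 0) - (if p = s then hop r q g S else 0)" for p q r s
    using fun_cong[OF hop_commutator[of p q r s g], of S] by (auto split: if_splits)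
  have "fermion_action N X (fermion_action N Y g) S - fermion_action N Y (fermion_action N X g) S =
    (\<Sum>p<N. \<Sum>q<N. \<Sum>r<N. \<Sum>s<N. X $$ (p, q) * Y $$ (r, s) *
      ((if q = r then hop p s g S else 0) - (if p = s then hop r q g S else 0)))"
    unfolding comp[of X Y] comp' by (simp flip: sum_subtractf right_diff_distrib comm)
  also have "\<dots> = (\<Sum>p<N. \<Sum>q<N. \<Sum>r<N. \<Sum>s<N. if q = r then X $$ (p, q) * Y $$ (r, s) * hop p s g S else 0)
     - (\<Sum>p<N. \<Sum>q<N. \<Sum>r<N. \<Sum>s<N. if s = p then X $$ (p, q) * Y $$ (r, s) * hop r q g S else 0)"
    unfolding sum_subtractf[symmetric] by (intro sum.cong refl) (auto simp: right_diff_distrib)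
  also have "(\<Sum>p<N. \<Sum>q<N. \<Sum>r<N. \<Sum>s<N. if q = r then X $$ (p, q) * Y $$ (r, s) * hop p s g S else 0) =
     (\<Sum>p<N. \<Sum>q<N. \<Sum>s<N. X $$ (p, q) * Y $$ (q, s) * hop p s g S)"
    by (rule sum.cong[OF refl], rule sum.cong[OF refl], subst sum.swap) simp
  also have "\<dots> = (\<Sum>p<N. \<Sum>s<N. (\<Sum>q<N. X $$ (p, q) * Y $$ (q, s)) * hop p s g S)"
    by (rule sum.cong[OF refl], subst sum.swap) (simp add: sum_distrib_right)
  also have "(\<Sum>p<N. \<Sum>q<N. \<Sum>r<N. \<Sum>s<N. if s = p then X $$ (p, q) * Y $$ (r, s) * hop r q g S else 0) =
     (\<Sum>p<N. \<Sum>q<N. \<Sum>r<N. X $$ (p, q) * Y $$ (r, p) * hop r q g S)"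
    by simp
  also have "\<dots> = (\<Sum>p<N. \<Sum>r<N. \<Sum>q<N. X $$ (p, q) * Y $$ (r, p) * hop r q g S)"
    by (rule sum.cong[OF refl], subst sum.swap) simp
  also have "\<dots> = (\<Sum>r<N. \<Sum>p<N. \<Sum>q<N. X $$ (p, q) * Y $$ (r, p) * hop r q g S)"
    by (subst sum.swap) simp
  also have "\<dots> = (\<Sum>r<N. \<Sum>q<N. (\<Sum>p<N. Y $$ (r, p) * X $$ (p, q)) * hop r q g S)"
    by (rule sum.cong[OF refl], subst sum.swap) (simp add: sum_distrib_left mult_ac)
  finally show ?thesis
    using X Y by (simp add: fermion_action_def lie_bracket_index left_diff_distrib sum_subtractf)
qed

lemma fermion_action_linear:
  "fermion_action N X (\<lambda>S. g S + h S) S = fermion_action N X g S + fermion_action N X h S"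
  "fermion_action N X (\<lambda>S. z * g S) S = z * fermion_action N X g S"
  by (simp_all add: fermion_action_def hop_linear algebra_simps sum.distrib sum_distrib_left)

lemma fermion_action_linear_mat:
  assumes "X \<in> carrier_mat N N" "Y \<in> carrier_mat N N"
  shows "fermion_action N (X + Y) g S = fermion_action N X g S + fermion_action N Y g S"
    and "fermion_action N (z \<cdot>\<^sub>m X) g S = z * fermion_action N X g S"
  using assms by (simp_all add: fermion_action_def algebra_simps sum.distrib sum_distrib_left)

lemma fermion_action_particle_sets:
  assumes "\<And>S. S \<notin> particle_sets H N \<Longrightarrow> g S = 0" and "S \<notin> particle_sets H N"
  shows "fermion_action N X g S = 0"
  unfolding fermion_action_def using hop_particle_sets[OF assms(1)] assms(2) by (simp add: sum.neutral)

lemma fermion_action_elem_mat: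
  assumes "p < N" "q < N"
  shows "fermion_action N (elem_mat N p q) g S = hop p q g S"
proof -
  have "fermion_action N (elem_mat N p q) g S =
    (\<Sum>i<N. \<Sum>j<N. if j = q then (if i = p then hop p q g S else 0) else 0)"
    unfolding fermion_action_def by (intro sum.cong refl) auto
  then show ?thesis using assms by simp
qed

lemma fermion_action_chevalley:
  assumes "Suc p < N"
  shows "fermion_action N (chev_e N p) g S = (if can_hop_right p S then g (hop_right p S) else 0)"
    and "fermion_action N (chev_f N p) g S = (if can_hop_left p S then g (hop_left p S) else 0)"
    and "fermion_action N (chev_h N p) g S = (of_bool (p \<in> S) - of_bool (Suc p \<in> S)) * g S"
proof -
  have "fermion_action N (elem_mat N p p) g S =
      fermion_action N (chev_h N p + elem_mat N (Suc p) (Suc p)) g S"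
    by (intro arg_cong[of _ _ "\<lambda>X. fermion_action N X g S"] eq_matI)
      (auto simp: elem_mat_def chev_h_def)
  then show "fermion_action N (chev_h N p) g S = (of_bool (p \<in> S) - of_bool (Suc p \<in> S)) * g S"
    using assms by (simp add: fermion_action_linear_mat fermion_action_elem_mat hop_diag eq_neg_iff_add_eq_0 split: if_splits)
qed (use assms in \<open>simp_all add: chev_e_def chev_f_def fermion_action_elem_mat hop_from_right hop_from_left\<close>)

section \<open>Young diagrams in a rectangle and their Maya diagrams\<close>

lemma young_diagramsI:
  assumes "Y \<subseteq> R" "\<And>i j i' j'. \<lbrakk>(i, j) \<in> Y; (i', j') \<in> R; i' \<le> i; j' \<le> j\<rbrakk> \<Longrightarrow> (i', j') \<in> Y"
  shows "Y \<in> young_diagrams R"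
  using assms unfolding young_diagrams_def by blast

lemma young_diagramsD:
  assumes "Y \<in> young_diagrams R"
  shows "Y \<subseteq> R" "\<lbrakk>(i, j) \<in> Y; (i', j') \<in> R; i' \<le> i; j' \<le> j\<rbrakk> \<Longrightarrow> (i', j') \<in> Y"
  using assms unfolding young_diagrams_def by blast+

lemma down_closed_nat_interval:
  fixes A :: "nat set"
  assumes fin: "finite A" and ge: "\<And>x. x \<in> A \<Longrightarrow> m \<le> x"
    and down: "\<And>x x'. \<lbrakk>x \<in> A; m \<le> x'; x' \<le> x\<rbrakk> \<Longrightarrow> x' \<in> A"
  shows "A = {m..<m + card A}"
proof (cases "A = {}")
  case False
  have A: "A = {m..Max A}"
  proof (intro equalityI subsetI)
    show "x \<in> {m..Max A}" if "x \<in> A" for x using that ge Max_ge[OF fin that] by simp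
    show "x \<in> A" if "x \<in> {m..Max A}" for x using that down[OF Max_in[OF fin False], of x] by simp
  qed
  then have "card A = Suc (Max A) - m" by (metis card_atLeastAtMost)
  moreover have "m \<le> Max A" using ge Max_in[OF fin False] by blast
  ultimately have "Suc (Max A) = m + card A" by simp
  then show ?thesis using A by (metis atLeastLessThanSuc_atLeastAtMost)
qed simp

lemma strict_mono_on_image_eqD:
  fixes s s' :: "nat \<Rightarrow> nat"
  assumes "strict_mono_on {..<H} s" "strict_mono_on {..<H} s'" "s ` {..<H} = s' ` {..<H}" "t < H"
  shows "s t = s' t"
proof -
  have *: "map s [0..<H] = sorted_list_of_set (s ` {..<H})" if "strict_mono_on {..<H} s" for s :: "nat \<Rightarrow> nat"
  proof -
    have "sorted_wrt (<) (map s [0..<H])"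
      using that by (auto simp: sorted_wrt_iff_nth_less strict_mono_on_def)
    then have "sorted (map s [0..<H])" "distinct (map s [0..<H])"
      by (simp_all only: strict_sorted_iff)
    then have "sorted_list_of_set (set (map s [0..<H])) = map s [0..<H]"
      by (rule sorted_list_of_set.idem_if_sorted_distinct)
    then show ?thesis by (simp add: atLeast0LessThan)
  qed
  have "map s [0..<H] = map s' [0..<H]"
    using assms *[of s] *[of s'] by simp
  then show ?thesis using assms(4) by simp
qed

locale block_rectangle =
  fixes x0 x1 y0 y1 :: nat
  assumes x_le: "x0 \<le> x1" and y_le: "y0 \<le> y1"
begin

definition blocks :: "block set" where
  "blocks = {x0..x1} \<times> {y0..y1}"

definition width :: nat where
  "width = Suc (x1 - x0)"

definition height :: nat where
  "height = Suc (y1 - y0)"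

abbreviation "young \<equiv> young_diagrams blocks"

fun position :: "block \<Rightarrow> nat" where
  "position (x, y) = (x - x0) + (y1 - y)"

text \<open>
  Rows are counted from the top of the rectangle, so that row lengths increase weakly with the row
  number and the position of a block is its column number plus its row number.
\<close>

definition row_length :: "block set \<Rightarrow> nat \<Rightarrow> nat" where
  "row_length Y t = card {x. (x, y1 - t) \<in> Y}"

definition diagram_of_rows :: "(nat \<Rightarrow> nat) \<Rightarrow> block set" where
  "diagram_of_rows r = {(x, y) \<in> blocks. x < x0 + r (y1 - y)}"

text \<open>
  The Maya diagram of a Young diagram.  The boundary path from the top left to the bottom right
  corner of the rectangle has \<open>width + height\<close> steps, and these are the numbers of the vertical ones.
\<close>

definition maya :: "block set \<Rightarrow> nat set" where
  "maya Y = (\<lambda>t. row_length Y t + t) ` {..<height}"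

lemma mem_blocks_row: "t < height \<Longrightarrow> (x, y1 - t) \<in> blocks \<longleftrightarrow> x0 \<le> x \<and> x \<le> x1"
  using y_le by (auto simp: blocks_def height_def)

lemma row_lt_height: "(x, y) \<in> blocks \<Longrightarrow> y1 - y < height \<and> y1 - (y1 - y) = y"
  by (auto simp: blocks_def height_def)

lemma finite_blocks: "finite blocks"
  by (simp add: blocks_def)

lemma finite_young: "finite young"
  by (rule finite_subset[of _ "Pow blocks"]) (auto simp: finite_blocks dest: young_diagramsD)

lemma row_eq:
  assumes Y: "Y \<in> young" and t: "t < height"
  shows "{x. (x, y1 - t) \<in> Y} = {x0..<x0 + row_length Y t}"
  unfolding row_length_def
proof (rule down_closed_nat_interval)
  have sub: "{x. (x, y1 - t) \<in> Y} \<subseteq> {x0..x1}"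
    using young_diagramsD(1)[OF Y] mem_blocks_row[OF t] by auto
  then show "finite {x. (x, y1 - t) \<in> Y}" by (rule finite_subset) simp
  show "x0 \<le> x" if "x \<in> {x. (x, y1 - t) \<in> Y}" for x using that sub by auto
  show "x' \<in> {x. (x, y1 - t) \<in> Y}" if "x \<in> {x. (x, y1 - t) \<in> Y}" "x0 \<le> x'" "x' \<le> x" for x x'
    using that sub young_diagramsD(2)[OF Y, of x "y1 - t" x' "y1 - t"] mem_blocks_row[OF t] by auto
qed

lemma mem_young_row:
  "Y \<in> young \<Longrightarrow> t < height \<Longrightarrow> (x, y1 - t) \<in> Y \<longleftrightarrow> x0 \<le> x \<and> x < x0 + row_length Y t"
  using row_eq[of Y t] by (simp only: set_eq_iff mem_Collect_eq atLeastLessThan_iff)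

lemma row_length_le_width:
  assumes "Y \<in> young" "t < height"
  shows "row_length Y t \<le> width"
proof -
  have "{x. (x, y1 - t) \<in> Y} \<subseteq> {x0..x1}"
    using young_diagramsD(1)[OF assms(1)] mem_blocks_row[OF assms(2)] by auto
  then have "row_length Y t \<le> card {x0..x1}"
    unfolding row_length_def by (intro card_mono) auto
  then show ?thesis using x_le by (simp add: width_def)
qed

lemma row_length_mono:
  assumes Y: "Y \<in> young" and "t \<le> t'" "t' < height"
  shows "row_length Y t \<le> row_length Y t'"
proof -
  have "{x. (x, y1 - t) \<in> Y} \<subseteq> {x. (x, y1 - t') \<in> Y}"
  proof
    fix x assume x: "x \<in> {x. (x, y1 - t) \<in> Y}"
    then have "(x, y1 - t') \<in> blocks"
      using young_diagramsD(1)[OF Y] mem_blocks_row[of t x] mem_blocks_row[of t' x] assms by auto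
    then show "x \<in> {x. (x, y1 - t') \<in> Y}"
      using x young_diagramsD(2)[OF Y, of x "y1 - t" x "y1 - t'"] assms(2) by simp
  qed
  moreover have "finite {x. (x, y1 - t') \<in> Y}"
    unfolding row_eq[OF Y assms(3)] by (rule finite_atLeastLessThan)
  ultimately show ?thesis unfolding row_length_def by (intro card_mono)
qed

lemma mem_diagram_of_rows:
  "(x, y) \<in> diagram_of_rows r \<longleftrightarrow> (x, y) \<in> blocks \<and> x < x0 + r (y1 - y)"
  by (simp add: diagram_of_rows_def)

lemma diagram_of_rows_young:
  assumes "\<And>t t'. \<lbrakk>t \<le> t'; t' < height\<rbrakk> \<Longrightarrow> r t \<le> r t'"
  shows "diagram_of_rows r \<in> young"
proof (rule young_diagramsI)
  fix i j i' j'
  assume *: "(i, j) \<in> diagram_of_rows r" "(i', j') \<in> blocks" "i' \<le> i" "j' \<le> j"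
  then have "r (y1 - j) \<le> r (y1 - j')"
    using row_lt_height[of i' j'] by (intro assms) auto
  then show "(i', j') \<in> diagram_of_rows r"
    using * by (auto simp: mem_diagram_of_rows)
qed (auto simp: mem_diagram_of_rows)

lemma row_length_diagram_of_rows:
  assumes "t < height" "r t \<le> width"
  shows "row_length (diagram_of_rows r) t = r t"
proof -
  have "t \<le> y1" using assms(1) by (simp add: height_def)
  then have "(x, y1 - t) \<in> diagram_of_rows r \<longleftrightarrow> x0 \<le> x \<and> x \<le> x1 \<and> x < x0 + r t" for x
    by (simp add: mem_diagram_of_rows mem_blocks_row[OF assms(1)])
  moreover have "x \<le> x1" if "x < x0 + r t" for x
    using that assms(2) x_le by (simp add: width_def)
  ultimately have "{x. (x, y1 - t) \<in> diagram_of_rows r} = {x0..<x0 + r t}"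
    by auto
  then show ?thesis by (simp add: row_length_def)
qed

lemma diagram_of_row_length:
  assumes "Y \<in> young"
  shows "diagram_of_rows (row_length Y) = Y"
proof -
  have "(x, y) \<in> Y \<longleftrightarrow> (x, y) \<in> blocks \<and> x < x0 + row_length Y (y1 - y)" for x y
    using mem_young_row[OF assms, of "y1 - y" x] row_lt_height[of x y] young_diagramsD(1)[OF assms]
    by (auto simp: blocks_def)
  then show ?thesis by (auto simp: mem_diagram_of_rows)
qed

lemma diagram_of_rows_cong:
  "(\<And>t. t < height \<Longrightarrow> r t = r' t) \<Longrightarrow> diagram_of_rows r = diagram_of_rows r'"
  using row_lt_height by (auto simp: diagram_of_rows_def)

lemma maya_strict_mono: "Y \<in> young \<Longrightarrow> strict_mono_on {..<height} (\<lambda>t. row_length Y t + t)"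
  by (auto simp: strict_mono_on_def intro!: add_le_less_mono row_length_mono)

lemma maya_particle_sets:
  assumes "Y \<in> young"
  shows "maya Y \<in> particle_sets height (width + height)"
proof -
  have "card (maya Y) = height"
    using strict_mono_on_imp_inj_on[OF maya_strict_mono[OF assms]] by (simp add: maya_def card_image)
  then show ?thesis
    using row_length_le_width[OF assms] by (auto simp: particle_sets_def maya_def intro!: add_le_less_mono)
qed

lemma inj_on_maya: "inj_on maya young"
proof (rule inj_onI)
  fix Y Y' assume Y: "Y \<in> young" "Y' \<in> young" "maya Y = maya Y'"
  have "row_length Y t = row_length Y' t" if "t < height" for t
    using strict_mono_on_image_eqD[OF maya_strict_mono[OF Y(1)] maya_strict_mono[OF Y(2)] _ that] Y(3)
    by (simp add: maya_def)
  then show "Y = Y'"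
    using diagram_of_rows_cong diagram_of_row_length Y by metis
qed

text \<open>
  Subtracting \<open>t\<close> from the \<open>t\<close>-th smallest element of the set recovers the row lengths.
\<close>

lemma particle_sets_in_maya:
  assumes "S \<in> particle_sets height (width + height)"
  shows "S \<in> maya ` young"
proof -
  have S: "S \<subseteq> {..<width + height}" "card S = height" using assms by (auto simp: particle_sets_def)
  have fin: "finite S" using S(1) by (rule finite_subset) simp
  define s where "s t = sorted_list_of_set S ! t" for t
  have len: "length (sorted_list_of_set S) = height" using S by simp
  have s_mono: "s t < s t'" if "t < t'" "t' < height" for t t'
    using that len by (auto simp: s_def intro!: sorted_wrt_nth_less[OF strict_sorted_list_of_set])
  have img: "s ` {..<height} = S"
    using nth_image[of height "sorted_list_of_set S"] fin len by (simp add: s_def[abs_def] atLeast0LessThan)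
  \<comment> \<open>Consecutive particles are at least one apart, hence both bounds on the gaps.\<close>
  have gap: "s t + d \<le> s (t + d)" if "t + d < height" for t d
    using that
  proof (induction d)
    case (Suc d)
    then show ?case using s_mono[of "t + d" "t + Suc d"] by simp
  qed simp
  have t_le: "t \<le> s t" if "t < height" for t
    using gap[of 0 t] that by simp
  define r where "r t = s t - t" for t
  have r_mono: "r t \<le> r t'" if "t \<le> t'" "t' < height" for t t'
    using gap[of t "t' - t"] that t_le[of t] by (simp add: r_def)
  have r_le: "r t \<le> width" if "t < height" for t
  proof -
    have "s (height - 1) \<in> S" using img that by force
    then have "s (height - 1) < width + height" using S(1) by auto
    then show ?thesis using gap[of t "height - 1 - t"] that by (simp add: r_def)
  qed
  have "maya (diagram_of_rows r) = (\<lambda>t. r t + t) ` {..<height}"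
    unfolding maya_def by (rule image_cong) (auto simp: row_length_diagram_of_rows r_le)
  also have "\<dots> = s ` {..<height}"
    by (rule image_cong) (auto simp: r_def t_le)
  finally show ?thesis
    using diagram_of_rows_young[of r] r_mono img by (metis imageI)
qed

lemma bij_maya: "bij_betw maya young (particle_sets height (width + height))"
  using inj_on_maya maya_particle_sets particle_sets_in_maya by (auto intro!: bij_betw_imageI)

definition diagram :: "nat set \<Rightarrow> block set" where
  "diagram = the_inv_into young maya"

lemma diagram_maya [simp]: "Y \<in> young \<Longrightarrow> diagram (maya Y) = Y"
  unfolding diagram_def by (rule the_inv_into_f_f[OF inj_on_maya])

lemma maya_diagram [simp]: "S \<in> particle_sets height (width + height) \<Longrightarrow> maya (diagram S) = S"
  unfolding diagram_def using bij_maya f_the_inv_into_f_bij_betw by metis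

lemma diagram_young [simp]: "S \<in> particle_sets height (width + height) \<Longrightarrow> diagram S \<in> young"
  using particle_sets_in_maya[of S] by (metis diagram_maya imageE)

text \<open>
  A block that can be added lies at the end of its row \<open>t\<close>, so its position \<open>p\<close> is the \<open>t\<close>-th
  element of the Maya diagram, which moves to \<open>Suc p\<close>.  That site is free because the next row, if
  there is one, is strictly longer.
\<close>

lemma maya_insert:
  assumes Y: "Y \<in> young" and s: "s \<notin> Y" and Y': "insert s Y \<in> young"
  shows "can_hop_right (position s) (maya Y) \<and> maya (insert s Y) = hop_right (position s) (maya Y)"
proof -
  obtain x y where xy: "s = (x, y)" by (cases s)
  have b: "(x, y) \<in> blocks" using young_diagramsD(1)[OF Y'] xy by auto
  define t where "t = y1 - y"
  have t: "t < height" "y = y1 - t" and x: "x0 \<le> x" using row_lt_height[OF b] b by (auto simp: t_def blocks_def)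
  let ?r = "row_length Y" and ?r' = "row_length (insert s Y)"
  have rows: "{x'. (x', y1 - t') \<in> insert s Y} = (if t' = t then insert x {x'. (x', y1 - t) \<in> Y} else {x'. (x', y1 - t') \<in> Y})"
    if "t' < height" for t'
    using that t xy y_le by (auto simp: height_def)
  have r't: "?r' t = Suc (?r t)"
  proof -
    have "finite {x'. (x', y1 - t) \<in> Y}"
      unfolding row_eq[OF Y t(1)] by (rule finite_atLeastLessThan)
    moreover have "x \<notin> {x'. (x', y1 - t) \<in> Y}" using s xy t by simp
    ultimately show ?thesis
      unfolding row_length_def rows[OF t(1)] by simp
  qed
  have r': "?r' t' = ?r t'" if "t' < height" "t' \<noteq> t" for t'
    unfolding row_length_def rows[OF that(1)] using that by simp
  have "x0 + ?r t \<le> x" using s xy t x mem_young_row[OF Y t(1)] by force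
  moreover have "x < x0 + ?r' t" using xy t x mem_young_row[OF Y' t(1)] by force
  ultimately have x_eq: "x = x0 + ?r t" using r't by simp
  have pos: "position s = ?r t + t" using xy x_eq t_def by simp
  let ?s = "\<lambda>t. ?r t + t"
  have inj: "?s t' = ?s u \<longleftrightarrow> t' = u" if "t' < height" "u < height" for t' u
    using strict_mono_on_imp_inj_on[OF maya_strict_mono[OF Y]] that by (auto simp: inj_on_def)
  have "?s t' \<noteq> Suc (?s t)" if t': "t' < height" for t'
  proof
    assume eq: "?s t' = Suc (?s t)"
    have "t < t'"
    proof (rule ccontr)
      assume "\<not> t < t'"
      then have "?r t' \<le> ?r t" using row_length_mono[OF Y, of t' t] t by simp
      then show False using eq \<open>\<not> t < t'\<close> by simp
    qed
    then have "?r' t \<le> ?r' t'" using row_length_mono[OF Y', of t t'] t' by simp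
    then have "Suc (?r t) \<le> ?r t'" using r't r' t' \<open>t < t'\<close> by simp
    then show False using eq \<open>t < t'\<close> by simp
  qed
  then have "Suc (?s t) \<notin> maya Y" by (force simp: maya_def)
  moreover have "?s t \<in> maya Y" using t by (auto simp: maya_def)
  moreover have "maya (insert s Y) = insert (Suc (?s t)) (maya Y - {?s t})"
  proof -
    have split: "{..<height} = insert t ({..<height} - {t})" using t by auto
    have "maya (insert s Y) = insert (?r' t + t) ((\<lambda>t. ?r' t + t) ` ({..<height} - {t}))"
      unfolding maya_def using arg_cong[OF split, of "image (\<lambda>t. ?r' t + t)"]
      by (simp only: image_insert)
    also have "(\<lambda>t. ?r' t + t) ` ({..<height} - {t}) = ?s ` ({..<height} - {t})"
      using r' by (intro image_cong) auto
    also have "\<dots> = maya Y - {?s t}"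
      using inj t by (auto simp: maya_def)
    finally show ?thesis using r't by simp
  qed
  ultimately show ?thesis by (simp add: pos can_hop_right_def hop_right_def)
qed

text \<open>
  Conversely, if the \<open>t\<close>-th particle can hop, then the next row is strictly longer, and row \<open>t\<close>
  does not yet fill the rectangle: if it did, so would all later rows, and the site to the right
  would be occupied or lie beyond the last one.
\<close>

lemma block_for_hop:
  assumes Y: "Y \<in> young" and p: "can_hop_right p (maya Y)" "Suc p < width + height"
  shows "\<exists>s. s \<notin> Y \<and> insert s Y \<in> young \<and> position s = p"
proof -
  let ?r = "row_length Y"
  obtain t where t: "t < height" "p = ?r t + t" and Sp: "Suc p \<notin> maya Y"
    using p by (auto simp: can_hop_right_def maya_def)
  have next_row: "?r t < ?r (Suc t)" if "Suc t < height"
  proof (rule ccontr)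
    assume "\<not> ?thesis"
    then have "?r (Suc t) = ?r t" using row_length_mono[OF Y, of t "Suc t"] that by simp
    then have "Suc p \<in> maya Y" using t that by (force simp: maya_def)
    then show False using Sp by simp
  qed
  have lt: "?r t < width"
  proof (cases "Suc t < height")
    case True
    then show ?thesis using next_row row_length_le_width[OF Y True] by simp
  next
    case False
    then show ?thesis using t p(2) by simp
  qed
  let ?s = "(x0 + ?r t, y1 - t)"
  have "?s \<notin> Y" using mem_young_row[OF Y t(1)] by simp
  moreover have "insert ?s Y = diagram_of_rows (?r(t := Suc (?r t)))"
  proof -
    have "(x, y) \<in> insert ?s Y \<longleftrightarrow> (x, y) \<in> diagram_of_rows (?r(t := Suc (?r t)))" for x y
    proof -
      have Yd: "(x, y) \<in> Y \<longleftrightarrow> (x, y) \<in> blocks \<and> x < x0 + ?r (y1 - y)"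
        using mem_diagram_of_rows[of x y ?r] by (simp only: diagram_of_row_length[OF Y])
      have "?s \<in> blocks" using lt t x_le by (auto simp: mem_blocks_row width_def)
      moreover have "y1 - (y1 - t) = t" using t y_le by (simp add: height_def)
      moreover have "(x, y) \<in> blocks \<Longrightarrow> y1 - y = t \<Longrightarrow> y = y1 - t"
        using row_lt_height by auto
      ultimately show ?thesis
        unfolding mem_diagram_of_rows using Yd by (auto simp: less_Suc_eq)
    qed
    then show ?thesis by auto
  qed
  moreover have "diagram_of_rows (?r(t := Suc (?r t))) \<in> young"
  proof (rule diagram_of_rows_young)
    fix u u' assume u: "u \<le> u'" "u' < height"
    have "Suc (?r t) \<le> ?r u'" if "t < u'"
      using next_row row_length_mono[OF Y, of "Suc t" u'] u that by simp
    then show "(?r(t := Suc (?r t))) u \<le> (?r(t := Suc (?r t))) u'"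
      using row_length_mono[OF Y u] u by (auto simp: le_less)
  qed
  moreover have "position ?s = p" using t y_le by (simp add: height_def)
  ultimately show ?thesis by metis
qed

end

section \<open>The Fock space operators in terms of Maya diagrams\<close>

lemma sum_fun_apply: "(sum f A) z = (\<Sum>a\<in>A. f a z)" for f :: "'a \<Rightarrow> 'b \<Rightarrow> complex"
  by (induction A rule: infinite_finite_induct) simp_all

lemma extend_linearly_apply:
  "extend_linearly R g x Z = (\<Sum>Y\<in>young_diagrams R. x Y * g Y Z)"
  by (simp add: extend_linearly_def sum_fun_apply fscale_def)

lemma vector_space_fscale: "vector_space fscale"
  by unfold_locales (auto simp: fscale_def algebra_simps)

lemma fscale_apply: "fscale z x Y = z * x Y"
  by (simp add: fscale_def)

lemma ket_fock_space: "Y \<in> young_diagrams R \<Longrightarrow> ket Y \<in> fock_space R"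
  by (auto simp: fock_space_def ket_def)

locale labelled_rectangle = block_rectangle +
  fixes n :: nat
  assumes one_diagonal_per_label:
    "\<And>s t. \<lbrakk>s \<in> blocks; t \<in> blocks; label n s = label n t\<rbrakk> \<Longrightarrow> diagonal s = diagonal t"
begin

abbreviation N :: nat where
  "N \<equiv> width + height"

text \<open>
  The label carried by the diagonal at distance \<open>p\<close> from the top left block; it is the vertex number
  \<open>p\<close> of the Dynkin diagram.
\<close>

definition vertex :: "nat \<Rightarrow> int" where
  "vertex p = (int x0 - int y1 + int p) mod (int n + 1)"

lemma diagonal_position: "s \<in> blocks \<Longrightarrow> diagonal s = int x0 - int y1 + int (position s)"
  by (cases s) (auto simp: blocks_def of_nat_diff)

lemma label_position: "s \<in> blocks \<Longrightarrow> label n s = vertex (position s)"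
  by (simp add: label_def vertex_def diagonal_position)

lemma position_less: "s \<in> blocks \<Longrightarrow> Suc (position s) < N"
  by (cases s) (auto simp: blocks_def width_def height_def)

lemma block_at_position:
  assumes "Suc p < N"
  shows "\<exists>s\<in>blocks. position s = p"
proof (cases "p \<le> x1 - x0")
  case True
  then show ?thesis
    using x_le y_le by (intro bexI[of _ "(x0 + p, y1)"]) (auto simp: blocks_def)
next
  case False
  then show ?thesis
    using x_le y_le assms
    by (intro bexI[of _ "(x1, y1 - (p - (x1 - x0)))"]) (auto simp: blocks_def width_def height_def)
qed

lemma vertex_eq_iff:
  assumes "Suc p < N" "Suc q < N"
  shows "vertex p = vertex q \<longleftrightarrow> p = q"
proof
  assume eq: "vertex p = vertex q"
  obtain s t where "s \<in> blocks" "position s = p" "t \<in> blocks" "position t = q"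
    using block_at_position assms by metis
  then show "p = q"
    using one_diagonal_per_label[of s t] eq by (simp add: label_position diagonal_position)
qed simp

lemma label_eq_vertex_iff:
  "s \<in> blocks \<Longrightarrow> Suc p < N \<Longrightarrow> label n s = vertex p \<longleftrightarrow> position s = p"
  using label_position vertex_eq_iff position_less by metis

text \<open>
  The diagonals at positions \<open>0\<close> and \<open>n + 1\<close> have the same label, so only \<open>n + 1\<close> diagonals fit.
  Equality is possible: the Dynkin path then uses all vertices of the cycle.
\<close>

lemma size_bound: "N \<le> n + 2"
proof (rule ccontr)
  assume "\<not> ?thesis"
  moreover have "vertex (Suc n) = vertex 0"
  proof -
    have "int x0 - int y1 + int (Suc n) = int x0 - int y1 + (int n + 1)" by simp
    then show ?thesis unfolding vertex_def by (simp only: mod_add_self2) simp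
  qed
  ultimately show False
    using vertex_eq_iff[of "Suc n" 0] by simp
qed

lemma vertex_pos_vertex:
  assumes "Suc p < N"
  shows "vertex_pos n (vertex 0) (vertex p) = p"
proof -
  have "(vertex p - vertex 0) mod (int n + 1) = int p mod (int n + 1)"
    by (simp add: vertex_def mod_diff_eq)
  then show ?thesis
    using assms size_bound by (simp add: vertex_pos_def)
qed

lemma dynkin_vertices_eq: "dynkin_vertices n (vertex 0) (vertex (N - 2)) = vertex ` {p. Suc p < N}"
proof -
  have N2: "2 \<le> N" by (simp add: width_def height_def)
  have "(vertex (N - 2) - vertex 0) mod (int n + 1) = int (N - 2) mod (int n + 1)"
    by (simp add: vertex_def mod_diff_eq)
  also have "\<dots> = int (N - 2)" using size_bound by simp
  finally have len: "(vertex (N - 2) - vertex 0) mod (int n + 1) = int (N - 2)" .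
  have step: "(vertex 0 + int p) mod (int n + 1) = vertex p" for p
    by (simp add: vertex_def mod_add_left_eq)
  show ?thesis
  proof (intro equalityI subsetI)
    fix i assume "i \<in> dynkin_vertices n (vertex 0) (vertex (N - 2))"
    then obtain k where k: "i = (vertex 0 + k) mod (int n + 1)" "0 \<le> k" "k \<le> int (N - 2)"
      by (auto simp only: dynkin_vertices_def len mem_Collect_eq)
    then have "i = vertex (nat k)" "Suc (nat k) < N" using step[of "nat k"] N2 by auto
    then show "i \<in> vertex ` {p. Suc p < N}" by blast
  next
    fix i assume "i \<in> vertex ` {p. Suc p < N}"
    then obtain p where p: "i = vertex p" "Suc p < N" by blast
    then show "i \<in> dynkin_vertices n (vertex 0) (vertex (N - 2))"
      unfolding dynkin_vertices_def len mem_Collect_eq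
      by (intro exI[of _ "int p"]) (simp add: step)
  qed
qed

lemma card_dynkin_vertices: "card (dynkin_vertices n (vertex 0) (vertex (N - 2))) + 1 = N"
proof -
  have "inj_on vertex {p. Suc p < N}" by (auto simp: inj_on_def vertex_eq_iff)
  moreover have "{p. Suc p < N} = {..<N - 1}" by auto
  ultimately have "card (dynkin_vertices n (vertex 0) (vertex (N - 2))) = N - 1"
    unfolding dynkin_vertices_eq by (simp add: card_image)
  then show ?thesis by (simp add: width_def)
qed

lemma is_fock_action_iff:
  "is_fock_action n (vertex 0) (vertex (N - 2)) blocks \<rho> \<longleftrightarrow>
     sl_representation fscale N (fock_space blocks) \<rho> \<and>
     (\<forall>p x. Suc p < N \<longrightarrow> x \<in> fock_space blocks \<longrightarrow>
        \<rho> (chev_e N p) x = op_e n blocks (vertex p) x \<and>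
        \<rho> (chev_f N p) x = op_f n blocks (vertex p) x \<and>
        \<rho> (chev_h N p) x = op_h n blocks (vertex p) x)"
  unfolding is_fock_action_def Let_def card_dynkin_vertices
  unfolding dynkin_vertices_eq by (auto simp: vertex_pos_vertex)

lemma addable_eq:
  assumes Y: "Y \<in> young" and p: "Suc p < N"
  shows "addable n blocks (vertex p) Y = {s. s \<notin> Y \<and> insert s Y \<in> young \<and> position s = p}"
proof -
  have "label n s = vertex p \<longleftrightarrow> position s = p" if "insert s Y \<in> young" for s
    using young_diagramsD(1)[OF that] p by (intro label_eq_vertex_iff) auto
  then show ?thesis
    unfolding addable_def by (intro Collect_cong) auto
qed

lemma removable_eq:
  assumes Y: "Y \<in> young" and p: "Suc p < N"
  shows "removable n blocks (vertex p) Y = {s. s \<in> Y \<and> Y - {s} \<in> young \<and> position s = p}"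
proof -
  have "label n s = vertex p \<longleftrightarrow> position s = p" if "s \<in> Y" for s
    using young_diagramsD(1)[OF Y] that p by (intro label_eq_vertex_iff) auto
  then show ?thesis
    unfolding removable_def by (intro Collect_cong) auto
qed

text \<open>
  There is at most one addable block of a given label, since the resulting Maya diagram, and hence
  the resulting Young diagram, is determined by the label.
\<close>

lemma addable_singleton:
  assumes Y: "Y \<in> young" and p: "Suc p < N" and hop: "can_hop_right p (maya Y)"
  shows "\<exists>s. addable n blocks (vertex p) Y = {s} \<and> Y \<union> {s} = diagram (hop_right p (maya Y))"
proof -
  have eq: "insert s Y = diagram (hop_right p (maya Y))"
    if "s \<notin> Y" "insert s Y \<in> young" "position s = p" for s
    using maya_insert[OF Y that(1,2)] that diagram_maya by metis
  obtain s where s: "s \<notin> Y" "insert s Y \<in> young" "position s = p"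
    using block_for_hop[OF Y hop p] by blast
  have "s' = s" if "s' \<notin> Y" "insert s' Y \<in> young" "position s' = p" for s'
    using eq[OF that] eq[OF s] that s by blast
  then have "addable n blocks (vertex p) Y = {s}"
    unfolding addable_eq[OF Y p] using s by blast
  then show ?thesis using eq[OF s] by auto
qed

lemma addable_empty:
  assumes Y: "Y \<in> young" and p: "Suc p < N" and hop: "\<not> can_hop_right p (maya Y)"
  shows "addable n blocks (vertex p) Y = {}"
  unfolding addable_eq[OF Y p] using maya_insert[OF Y] hop by blast

lemma maya_remove:
  assumes Y: "Y \<in> young" and s: "s \<in> Y" "Y - {s} \<in> young"
  shows "can_hop_left (position s) (maya Y)" "Y - {s} = diagram (hop_left (position s) (maya Y))"
proof -
  have "insert s (Y - {s}) = Y" using s by blast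
  then have *: "can_hop_right (position s) (maya (Y - {s}))" "maya Y = hop_right (position s) (maya (Y - {s}))"
    using maya_insert[OF s(2), of s] Y by auto
  then show "can_hop_left (position s) (maya Y)" by (simp add: can_hop_left_hop_right)
  show "Y - {s} = diagram (hop_left (position s) (maya Y))"
    using * s(2) by (simp add: hop_left_right)
qed

lemma removable_singleton:
  assumes Y: "Y \<in> young" and p: "Suc p < N" and hop: "can_hop_left p (maya Y)"
  shows "\<exists>s. removable n blocks (vertex p) Y = {s} \<and> Y - {s} = diagram (hop_left p (maya Y))"
proof -
  define Y0 where "Y0 = diagram (hop_left p (maya Y))"
  have S: "hop_left p (maya Y) \<in> particle_sets height N"
    using hop_left_particle_sets[OF maya_particle_sets[OF Y] hop] .
  have Y0: "Y0 \<in> young" "maya Y0 = hop_left p (maya Y)" using S by (simp_all add: Y0_def)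
  obtain s where s: "s \<notin> Y0" "insert s Y0 \<in> young" "position s = p"
    using block_for_hop[OF Y0(1) _ p] can_hop_right_hop_left[OF hop] Y0(2) by auto
  have "maya (insert s Y0) = maya Y"
    using maya_insert[OF Y0(1) s(1,2)] s(3) Y0(2) hop by (simp add: hop_right_left)
  then have Ys: "insert s Y0 = Y" using inj_on_maya Y s(2) by (meson inj_onD)
  then have s': "s \<in> Y" "Y - {s} = Y0" using s by blast+
  have "t = s" if "t \<in> Y" "Y - {t} \<in> young" "position t = p" for t
    using maya_remove(2)[OF Y that(1,2)] that s' by (auto simp: Y0_def)
  then have "removable n blocks (vertex p) Y = {s}"
    unfolding removable_eq[OF Y p] using s s' Y0 by blast
  then show ?thesis using s' by (auto simp: Y0_def)
qed

lemma removable_empty: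
  assumes Y: "Y \<in> young" and p: "Suc p < N" and hop: "\<not> can_hop_left p (maya Y)"
  shows "removable n blocks (vertex p) Y = {}"
  unfolding removable_eq[OF Y p] using maya_remove(1)[OF Y] hop by blast

lemma sum_removable:
  assumes "Y \<in> young" "Suc p < N"
  shows "(\<Sum>s\<in>removable n blocks (vertex p) Y. ket (Y - {s})) =
    (if can_hop_left p (maya Y) then ket (diagram (hop_left p (maya Y))) else 0)"
proof (cases "can_hop_left p (maya Y)")
  case True
  then obtain s where "removable n blocks (vertex p) Y = {s}" "Y - {s} = diagram (hop_left p (maya Y))"
    using removable_singleton[OF assms] by blast
  then show ?thesis using True by simp
qed (use removable_empty assms in simp)

lemma sum_addable:
  assumes "Y \<in> young" "Suc p < N"
  shows "(\<Sum>s\<in>addable n blocks (vertex p) Y. ket (Y \<union> {s})) =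
    (if can_hop_right p (maya Y) then ket (diagram (hop_right p (maya Y))) else 0)"
proof (cases "can_hop_right p (maya Y)")
  case True
  then obtain s where "addable n blocks (vertex p) Y = {s}" "Y \<union> {s} = diagram (hop_right p (maya Y))"
    using addable_singleton[OF assms] by blast
  then show ?thesis using True by simp
qed (use addable_empty assms in simp)

definition weight :: "nat \<Rightarrow> nat set \<Rightarrow> complex" where
  "weight p S = of_bool (p \<in> S) - of_bool (Suc p \<in> S)"

lemma card_addable_removable:
  assumes "Y \<in> young" "Suc p < N"
  shows "of_nat (card (addable n blocks (vertex p) Y)) - of_nat (card (removable n blocks (vertex p) Y))
    = weight p (maya Y)"
proof -
  have "card (addable n blocks (vertex p) Y) = of_bool (can_hop_right p (maya Y))"
    using addable_singleton[OF assms] addable_empty[OF assms]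
    by (cases "can_hop_right p (maya Y)") auto
  moreover have "card (removable n blocks (vertex p) Y) = of_bool (can_hop_left p (maya Y))"
    using removable_singleton[OF assms] removable_empty[OF assms]
    by (cases "can_hop_left p (maya Y)") auto
  ultimately show ?thesis by (auto simp: weight_def can_hop_right_def can_hop_left_def)
qed

lemma op_e_apply:
  assumes p: "Suc p < N"
  shows "op_e n blocks (vertex p) x Z =
    (if Z \<in> young \<and> can_hop_right p (maya Z) then x (diagram (hop_right p (maya Z))) else 0)"
proof -
  have "op_e n blocks (vertex p) x Z =
      (\<Sum>Y\<in>young. if Y = diagram (hop_right p (maya Z))
         then (if Z \<in> young \<and> can_hop_right p (maya Z) then x Y else 0) else 0)"
    unfolding op_e_def extend_linearly_apply
  proof (rule sum.cong[OF refl])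
    fix Y assume Y: "Y \<in> young"
    have "can_hop_left p (maya Y) \<and> Z = diagram (hop_left p (maya Y)) \<longleftrightarrow>
      Z \<in> young \<and> can_hop_right p (maya Z) \<and> Y = diagram (hop_right p (maya Z))" (is "?L \<longleftrightarrow> ?R")
    proof
      assume ?L
      then show ?R
        using Y hop_left_particle_sets[OF maya_particle_sets[OF Y]]
        by (auto simp: can_hop_right_hop_left hop_right_left)
    next
      assume ?R
      then show ?L
        using hop_right_particle_sets[OF maya_particle_sets[of Z] _ p]
        by (auto simp: can_hop_left_hop_right hop_left_right)
    qed
    then show "x Y * (\<Sum>s\<in>removable n blocks (vertex p) Y. ket (Y - {s})) Z =
      (if Y = diagram (hop_right p (maya Z)) then (if Z \<in> young \<and> can_hop_right p (maya Z) then x Y else 0) else 0)"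
      unfolding sum_removable[OF Y p] by (auto simp: ket_def)
  qed
  also have "\<dots> = (if Z \<in> young \<and> can_hop_right p (maya Z) then x (diagram (hop_right p (maya Z))) else 0)"
    using hop_right_particle_sets[OF maya_particle_sets[of Z] _ p] by (auto simp: sum.delta finite_young)
  finally show ?thesis .
qed

lemma op_f_apply:
  assumes p: "Suc p < N"
  shows "op_f n blocks (vertex p) x Z =
    (if Z \<in> young \<and> can_hop_left p (maya Z) then x (diagram (hop_left p (maya Z))) else 0)"
proof -
  have "op_f n blocks (vertex p) x Z =
      (\<Sum>Y\<in>young. if Y = diagram (hop_left p (maya Z))
         then (if Z \<in> young \<and> can_hop_left p (maya Z) then x Y else 0) else 0)"
    unfolding op_f_def extend_linearly_apply
  proof (rule sum.cong[OF refl])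
    fix Y assume Y: "Y \<in> young"
    have "can_hop_right p (maya Y) \<and> Z = diagram (hop_right p (maya Y)) \<longleftrightarrow>
      Z \<in> young \<and> can_hop_left p (maya Z) \<and> Y = diagram (hop_left p (maya Z))" (is "?L \<longleftrightarrow> ?R")
    proof
      assume ?L
      then show ?R
        using Y hop_right_particle_sets[OF maya_particle_sets[OF Y] _ p]
        by (auto simp: can_hop_left_hop_right hop_left_right)
    next
      assume ?R
      then show ?L
        using hop_left_particle_sets[OF maya_particle_sets[of Z]]
        by (auto simp: can_hop_right_hop_left hop_right_left)
    qed
    then show "x Y * (\<Sum>s\<in>addable n blocks (vertex p) Y. ket (Y \<union> {s})) Z =
      (if Y = diagram (hop_left p (maya Z)) then (if Z \<in> young \<and> can_hop_left p (maya Z) then x Y else 0) else 0)"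
      unfolding sum_addable[OF Y p] by (auto simp: ket_def)
  qed
  also have "\<dots> = (if Z \<in> young \<and> can_hop_left p (maya Z) then x (diagram (hop_left p (maya Z))) else 0)"
    using hop_left_particle_sets[OF maya_particle_sets[of Z]] by (auto simp: sum.delta finite_young)
  finally show ?thesis .
qed

lemma op_h_apply:
  assumes p: "Suc p < N"
  shows "op_h n blocks (vertex p) x Z = (if Z \<in> young then weight p (maya Z) * x Z else 0)"
proof -
  have "op_h n blocks (vertex p) x Z = (\<Sum>Y\<in>young. if Y = Z then weight p (maya Y) * x Y else 0)"
    unfolding op_h_def extend_linearly_apply
    by (rule sum.cong[OF refl]) (auto simp: card_addable_removable p fscale_def ket_def)
  then show ?thesis by (simp add: finite_young)
qed

lemma op_e_ket:
  assumes S: "S \<in> particle_sets height N" and p: "Suc p < N"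
  shows "op_e n blocks (vertex p) (ket (diagram S)) =
    (if can_hop_left p S then ket (diagram (hop_left p S)) else 0)"
proof
  fix Z
  have "op_e n blocks (vertex p) (ket (diagram S)) Z =
    (\<Sum>Y\<in>young. if Y = diagram S then (\<Sum>s\<in>removable n blocks (vertex p) Y. ket (Y - {s})) Z else 0)"
    unfolding op_e_def extend_linearly_apply by (rule sum.cong[OF refl]) (auto simp: ket_def)
  then show "op_e n blocks (vertex p) (ket (diagram S)) Z =
    (if can_hop_left p S then ket (diagram (hop_left p S)) else 0) Z"
    using S p by (simp add: finite_young sum_removable)
qed

lemma op_f_ket:
  assumes S: "S \<in> particle_sets height N" and p: "Suc p < N"
  shows "op_f n blocks (vertex p) (ket (diagram S)) =
    (if can_hop_right p S then ket (diagram (hop_right p S)) else 0)"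
proof
  fix Z
  have "op_f n blocks (vertex p) (ket (diagram S)) Z =
    (\<Sum>Y\<in>young. if Y = diagram S then (\<Sum>s\<in>addable n blocks (vertex p) Y. ket (Y \<union> {s})) Z else 0)"
    unfolding op_f_def extend_linearly_apply by (rule sum.cong[OF refl]) (auto simp: ket_def)
  then show "op_f n blocks (vertex p) (ket (diagram S)) Z =
    (if can_hop_right p S then ket (diagram (hop_right p S)) else 0) Z"
    using S p by (simp add: finite_young sum_addable del: Un_insert_right)
qed

section \<open>The action of the special linear algebra on the Fock space\<close>

text \<open>
  The action is transported from the exterior power along the bijection between Young diagrams and
  particle configurations.
\<close>

definition fermion_state :: "(block set \<Rightarrow> complex) \<Rightarrow> nat set \<Rightarrow> complex" where
  "fermion_state x = (\<lambda>S. if S \<in> particle_sets height N then x (diagram S) else 0)"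

definition fock_action :: "complex mat \<Rightarrow> (block set \<Rightarrow> complex) \<Rightarrow> block set \<Rightarrow> complex" where
  "fock_action X x = (\<lambda>Y. if Y \<in> young then fermion_action N X (fermion_state x) (maya Y) else 0)"

lemma fermion_state_fock_action:
  "fermion_state (fock_action X x) = fermion_action N X (fermion_state x)"
proof
  fix S
  show "fermion_state (fock_action X x) S = fermion_action N X (fermion_state x) S"
    using fermion_action_particle_sets[of height N "fermion_state x" S X]
    by (auto simp: fermion_state_def fock_action_def)
qed

lemma fermion_state_linear:
  "fermion_state (x + y) = (\<lambda>S. fermion_state x S + fermion_state y S)"
  "fermion_state (fscale z x) = (\<lambda>S. z * fermion_state x S)"
  by (auto simp: fermion_state_def fscale_def)

lemma sl_representation_fock_action: "sl_representation fscale N (fock_space blocks) fock_action"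
proof -
  interpret vector_space fscale by (rule vector_space_fscale)
  show ?thesis
  proof
    show "subspace (fock_space blocks)"
      by (intro subspaceI) (auto simp: fock_space_def fscale_def)
  next
    fix X Y x assume "X \<in> sl N" "Y \<in> sl N"
    then show "fock_action (lie_bracket X Y) x = fock_action X (fock_action Y x) - fock_action Y (fock_action X x)"
      unfolding fock_action_def[of X "fock_action Y x"] fock_action_def[of Y "fock_action X x"]
        fermion_state_fock_action
      by (auto simp: fock_action_def sl_def fermion_action_bracket)
  next
    fix X Y x assume "X \<in> sl N" "Y \<in> sl N"
    then show "fock_action (X + Y) x = fock_action X x + fock_action Y x"
      by (auto simp: fock_action_def sl_def fermion_action_linear_mat)
  next
    fix X x z assume "X \<in> sl N"
    then show "fock_action (z \<cdot>\<^sub>m X) x = fscale z (fock_action X x)"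
      by (auto simp: fock_action_def sl_def fermion_action_linear_mat fscale_def)
  qed (auto simp: fock_action_def fock_space_def fermion_state_linear fermion_action_linear fscale_apply)
qed

lemma is_fock_action_fock_action: "is_fock_action n (vertex 0) (vertex (N - 2)) blocks fock_action"
  unfolding is_fock_action_iff
proof (intro conjI allI impI sl_representation_fock_action ext)
  fix p x Z assume p: "Suc p < N" and "x \<in> fock_space blocks"
  show "fock_action (chev_e N p) x Z = op_e n blocks (vertex p) x Z"
    using hop_right_particle_sets[OF maya_particle_sets[of Z] _ p]
    by (auto simp: fock_action_def op_e_apply p fermion_action_chevalley fermion_state_def)
  show "fock_action (chev_f N p) x Z = op_f n blocks (vertex p) x Z"
    using hop_left_particle_sets[OF maya_particle_sets[of Z]]
    by (auto simp: fock_action_def op_f_apply p fermion_action_chevalley fermion_state_def)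
  show "fock_action (chev_h N p) x Z = op_h n blocks (vertex p) x Z"
    using maya_particle_sets[of Z]
    by (auto simp: fock_action_def op_h_apply p fermion_action_chevalley fermion_state_def weight_def)
qed

section \<open>Irreducibility of Fock actions\<close>

text \<open>
  The weights determine the differences of neighbouring occupation numbers, hence the occupation
  numbers up to a common constant, and the constant is fixed by the number of particles.
\<close>

lemma weights_separate:
  assumes S: "S \<in> particle_sets height N" and S': "S' \<in> particle_sets height N" and "S \<noteq> S'"
  shows "\<exists>p. Suc p < N \<and> weight p S \<noteq> weight p S'"
proof (rule ccontr)
  assume "\<not> ?thesis"
  then have eq: "weight p S = weight p S'" if "Suc p < N" for p using that by blast
  define d where "d p = of_bool (p \<in> S) - (of_bool (p \<in> S') :: complex)" for p
  have const: "d p = d 0" if "p < N" for p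
    using that
  proof (induction p)
    case (Suc p)
    have "d (Suc p) = d p"
    proof -
      have "x - y = x' - y' \<Longrightarrow> y - y' = x - x'" for x y x' y' :: complex
        by (simp add: algebra_simps)
      then show ?thesis
        using eq[OF Suc.prems] unfolding d_def weight_def by blast
    qed
    then show ?case using Suc by simp
  qed simp
  have sum: "(\<Sum>p<N. of_bool (p \<in> T)) = (of_nat height :: complex)" if "T \<in> particle_sets height N" for T
  proof -
    have "{..<N} \<inter> {p. p \<in> T} = T" using that by (auto simp: particle_sets_def)
    then show ?thesis using that by (simp add: particle_sets_def)
  qed
  have "of_nat N * d 0 = (\<Sum>p<N. d p)" using const by simp
  also have "\<dots> = 0" using sum[OF S] sum[OF S'] by (simp add: d_def sum_subtractf del: sum_of_bool_eq)
  finally have "of_nat N * d 0 = 0" .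
  moreover have "of_nat N \<noteq> (0 :: complex)"
    unfolding of_nat_eq_0_iff by (simp add: width_def)
  ultimately have "d 0 = 0" by (simp only: mult_eq_0_iff simp_thms)
  then have "p \<in> S \<longleftrightarrow> p \<in> S'" if "p < N" for p
    using const[OF that] \<open>d 0 = 0\<close> by (simp add: d_def of_bool_def split: if_splits)
  then show False using S S' \<open>S \<noteq> S'\<close> by (auto simp: particle_sets_def)
qed

lemma packed_particle_set: "{..<height} \<in> particle_sets height N"
  by (auto simp: particle_sets_def)

context
  fixes \<rho>
  assumes act: "is_fock_action n (vertex 0) (vertex (N - 2)) blocks \<rho>"
begin

interpretation sl_representation fscale N "fock_space blocks" \<rho>
  using act by (simp add: is_fock_action_iff)

lemma action_chevalley:
  assumes "Suc p < N" "x \<in> fock_space blocks"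
  shows "\<rho> (chev_e N p) x = op_e n blocks (vertex p) x"
    "\<rho> (chev_f N p) x = op_f n blocks (vertex p) x"
    "\<rho> (chev_h N p) x = op_h n blocks (vertex p) x"
  using act assms by (simp_all add: is_fock_action_iff)

text \<open>
  The kets are simultaneous eigenvectors of the coroots with pairwise distinct weights, so a
  subrepresentation contains every ket that occurs in one of its elements.
\<close>

lemma subrep_contains_ket:
  assumes U: "subrep U" and "u \<in> U" "u Y \<noteq> 0"
  shows "ket Y \<in> U"
  using assms(2,3)
proof (induction "card {Z. u Z \<noteq> 0}" arbitrary: u rule: less_induct)
  case less
  have sub: "subspace U" and UF: "U \<subseteq> fock_space blocks"
    using U by (auto simp: subrep_def)
  have supp: "{Z. u Z \<noteq> 0} \<subseteq> young" using less.prems UF by (auto simp: fock_space_def)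
  then have Yy: "Y \<in> young" using less.prems by auto
  show ?case
  proof (cases "\<exists>Z. Z \<noteq> Y \<and> u Z \<noteq> 0")
    case True
    then obtain Z where Z: "Z \<noteq> Y" "u Z \<noteq> 0" by blast
    then have Zy: "Z \<in> young" using supp by auto
    then have "maya Y \<noteq> maya Z" using Yy Z inj_on_maya by (auto dest: inj_onD)
    then obtain p where p: "Suc p < N" "weight p (maya Y) \<noteq> weight p (maya Z)"
      using weights_separate maya_particle_sets Yy Zy by blast
    \<comment> \<open>Subtracting the eigenvalue at \<open>Z\<close> removes \<open>Z\<close> from the support and keeps \<open>Y\<close>.\<close>
    define u' where "u' = \<rho> (chev_h N p) u - fscale (weight p (maya Z)) u"
    have u'_apply: "u' T = (weight p (maya T) - weight p (maya Z)) * u T" for T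
    proof -
      have "\<rho> (chev_h N p) u = op_h n blocks (vertex p) u"
        using action_chevalley(3)[OF p(1)] less.prems UF by blast
      moreover have "T \<notin> young \<Longrightarrow> u T = 0" using supp by auto
      ultimately show ?thesis
        by (simp add: u'_def op_h_apply[OF p(1)] fscale_apply left_diff_distrib)
    qed
    have "u' \<in> U"
      unfolding u'_def using U less.prems(1) chev_h_sl[OF p(1)] sub
      by (auto simp: subrep_def intro: subspace_diff subspace_scale)
    moreover have "{T. u' T \<noteq> 0} \<subset> {T. u T \<noteq> 0}"
      using Z by (auto simp: u'_apply)
    then have "card {T. u' T \<noteq> 0} < card {T. u T \<noteq> 0}"
      using supp finite_young by (meson finite_subset psubset_card_mono)
    moreover have "u' Y \<noteq> 0" using less.prems p by (simp add: u'_apply)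
    ultimately show ?thesis using less.hyps by blast
  next
    case False
    then have "ket Y = fscale (1 / u Y) u"
      using less.prems by (intro ext) (auto simp: ket_def fscale_def)
    then show ?thesis using sub less.prems by (simp add: subspace_scale)
  qed
qed

text \<open>
  The packed configuration is the empty Young diagram, and every diagram is reached from it by
  adding blocks one at a time.
\<close>

lemma subrep_with_vacuum:
  assumes U: "subrep U" and vac: "ket (diagram {..<height}) \<in> U"
  shows "U = fock_space blocks"
proof
  have sub: "subspace U" using U by (simp add: subrep_def)
  have "ket (diagram S) \<in> U" if "S \<in> particle_sets height N" for S
    using that
  proof (induction rule: particle_sets_induct)
    case packed
    show ?case by (rule vac)
  next
    case (hop S p)
    then have "\<rho> (chev_f N p) (ket (diagram S)) = ket (diagram (hop_right p S))"
      by (simp add: action_chevalley op_f_ket ket_fock_space)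
    then show ?case using hop U chev_f_sl by (metis subrep_def)
  qed
  then have ket: "ket Y \<in> U" if "Y \<in> young" for Y
    using that maya_particle_sets[OF that] by fastforce
  show "fock_space blocks \<subseteq> U"
  proof
    fix x assume x: "x \<in> fock_space blocks"
    have "(\<Sum>Y\<in>young. fscale (x Y) (ket Y)) = x"
    proof
      fix Z
      have "(\<Sum>Y\<in>young. fscale (x Y) (ket Y)) Z = (\<Sum>Y\<in>young. if Y = Z then x Y else 0)"
        unfolding sum_fun_apply by (rule sum.cong[OF refl]) (auto simp: fscale_def ket_def)
      then show "(\<Sum>Y\<in>young. fscale (x Y) (ket Y)) Z = x Z"
        using x by (auto simp: finite_young fock_space_def)
    qed
    moreover have "(\<Sum>Y\<in>young. fscale (x Y) (ket Y)) \<in> U"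
      by (intro subspace_sum[OF sub] subspace_scale[OF sub] ket)
    ultimately show "x \<in> U" by (simp only:)
  qed
  show "U \<subseteq> fock_space blocks" using U by (simp add: subrep_def)
qed

text \<open>
  Conversely, blocks can be removed from any diagram one at a time until it is empty.  There is
  only one removable block of each label, so each removal is the effect of a raising operator on a
  ket.
\<close>

lemma vacuum_in_subrep:
  assumes U: "subrep U" and "U \<noteq> {0}"
  shows "ket (diagram {..<height}) \<in> U"
proof -
  have "0 \<in> U" using U subspace_0 by (auto simp: subrep_def)
  then obtain u where u: "u \<in> U" "u \<noteq> 0" using assms(2) by blast
  then obtain Y where Y: "u Y \<noteq> 0" by (auto simp: fun_eq_iff)
  moreover have "u \<in> fock_space blocks" using u U by (auto simp: subrep_def)
  ultimately have Yy: "Y \<in> young" by (auto simp: fock_space_def)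
  have "ket (diagram S) \<in> U \<longrightarrow> ket (diagram {..<height}) \<in> U" if "S \<in> particle_sets height N" for S
    using that
  proof (induction rule: particle_sets_induct)
    case (hop S p)
    have S': "hop_right p S \<in> particle_sets height N"
      using hop by (simp add: hop_right_particle_sets)
    have "\<rho> (chev_e N p) (ket (diagram (hop_right p S))) = ket (diagram S)"
      using hop S'
      by (simp add: action_chevalley op_e_ket ket_fock_space can_hop_left_hop_right hop_left_right)
    then show ?case using hop U chev_e_sl by (metis subrep_def)
  qed simp
  then show ?thesis
    using subrep_contains_ket[OF U u(1) Y] maya_particle_sets[OF Yy] Yy by (metis diagram_maya)
qed

text \<open>
  Only the last particle of the packed configuration can move.  It sits at position \<open>height - 1\<close>,
  that of the bottom left block.
\<close>

lemma vacuum_highest_weight: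
  "highest_weight_vector (fundamental_weight (height - 1)) (ket (diagram {..<height}))"
proof -
  note S = packed_particle_set
  have "\<rho> (chev_e N p) (ket (diagram {..<height})) = 0" if "Suc p < N" for p
  proof -
    have "\<not> can_hop_left p {..<height}" by (auto simp: can_hop_left_def)
    then show ?thesis using that S by (simp add: action_chevalley op_e_ket ket_fock_space)
  qed
  moreover have "\<rho> (chev_h N p) (ket (diagram {..<height})) =
      fscale (fundamental_weight (height - 1) p) (ket (diagram {..<height}))" if p: "Suc p < N" for p
  proof
    fix Z
    have "weight p {..<height} = fundamental_weight (height - 1) p"
      by (auto simp: weight_def fundamental_weight_def height_def)
    then show "\<rho> (chev_h N p) (ket (diagram {..<height})) Z =
      fscale (fundamental_weight (height - 1) p) (ket (diagram {..<height})) Z"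
      using S p unfolding action_chevalley(3)[OF p ket_fock_space[OF diagram_young[OF S]]] op_h_apply[OF p]
      by (cases "Z = diagram {..<height}") (simp_all add: ket_def fscale_apply)
  qed
  moreover have "ket (diagram {..<height}) \<noteq> 0"
    by (auto simp: ket_def fun_eq_iff)
  ultimately show ?thesis
    using S by (simp add: highest_weight_vector_def ket_fock_space)
qed

lemma fock_space_irreducible_hw_rep:
  "is_irreducible_hw_rep fscale N (fock_space blocks) \<rho> (fundamental_weight (height - 1))"
proof -
  have "irreducible_rep"
    unfolding irreducible_rep_def
    using subrep_with_vacuum vacuum_in_subrep vacuum_highest_weight by (auto simp: highest_weight_vector_def)
  moreover have "highest_weight_rep (fundamental_weight (height - 1))"
    unfolding highest_weight_rep_def using subrep_with_vacuum vacuum_highest_weight by blast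
  ultimately show ?thesis
    unfolding is_irreducible_hw_rep_def using sl_representation_axioms by blast
qed

end

end

section \<open>The Fock space of a rectangle is a fundamental representation\<close>

theorem proposition4p10:
  fixes n :: nat and a b c :: int and R :: "block set"
  assumes "n \<ge> 1" and "is_rectangle n a b c R"
  defines "N \<equiv> card (dynkin_vertices n a c) + 1"
    and "\<Lambda>\<^sub>b \<equiv> fundamental_weight (vertex_pos n a b)"
  shows "(\<exists>\<rho>. is_fock_action n a c R \<rho>) \<and>
    (\<forall>\<rho>. is_fock_action n a c R \<rho> \<longrightarrow>
       is_irreducible_hw_rep fscale N (fock_space R) \<rho> \<Lambda>\<^sub>b \<and>
       (\<forall>(scale :: complex \<Rightarrow> 'v::ab_group_add \<Rightarrow> 'v) V \<sigma>.
          is_irreducible_hw_rep scale N V \<sigma> \<Lambda>\<^sub>b \<longrightarrow>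
          isomorphic_reps N fscale (fock_space R) \<rho> scale V \<sigma>))"
proof -
  obtain x0 x1 y0 y1 where rect: "x0 \<le> x1" "y0 \<le> y1" "R = {x0..x1} \<times> {y0..y1}"
      "label n (x0, y1) = a" "label n (x0, y0) = b" "label n (x1, y0) = c"
    and one: "\<forall>s\<in>R. \<forall>t\<in>R. label n s = label n t \<longrightarrow> diagonal s = diagonal t"
    using assms(2) unfolding is_rectangle_def by blast
  interpret block_rectangle x0 x1 y0 y1
    by unfold_locales (use rect in auto)
  have R: "blocks = R" by (simp add: blocks_def rect(3))
  interpret labelled_rectangle x0 x1 y0 y1 n
    by unfold_locales (use one R in blast)
  have "(x0, y1) \<in> blocks" "(x0, y0) \<in> blocks" "(x1, y0) \<in> blocks"
    using rect(1,2) by (auto simp: blocks_def)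
  then have a: "a = vertex 0" and b: "b = vertex (height - 1)" and c: "c = vertex (width + height - 2)"
    using rect(4-6) by (auto simp: label_position width_def height_def)
  have N: "N = width + height"
    unfolding N_def a c by (rule card_dynkin_vertices)
  have \<Lambda>: "\<Lambda>\<^sub>b = fundamental_weight (height - 1)"
    unfolding \<Lambda>\<^sub>b_def a b by (subst vertex_pos_vertex) (simp_all add: width_def height_def)
  show ?thesis
    unfolding N \<Lambda> a c R[symmetric]
    using is_fock_action_fock_action fock_space_irreducible_hw_rep irreducible_hw_rep_unique by blast
qed

end
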